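(* Let $f\colon\Gamma\to\Delta$ be a covering of profinite graphs, where $\Gamma$ is connected. Then the group of covering transformations $\operatorname{Aut}(\Gamma,f)$ is a profinite group that acts freely and uniformly equicontinuously on $\Gamma$.
   Context: A graph $\Gamma$ is a set that is the disjoint union of a set $V(\Gamma)$ of vertices and a set $E(\Gamma)$ of edges, with maps $s,t\colon E(\Gamma)\to V(\Gamma)$ and an involution $e\mapsto\overline e$ of $E(\Gamma)$ such that $\overline e\ne e$, $s(\overline e)=t(e)$, $t(\overline e)=s(e)$. A map of graphs sends vertices to vertices and edges to edges and commutes with $s$, $t$ and $e\mapsto\overline e$. It is locally bijective if for every vertex $v$ it restricts to a bijection from $\{e\mid s(e)=v\}$ onto $\{e'\mid s(e')=f(v)\}$. A graph is path connected if it is nonempty and any two vertices are joined by a finite edge path. An equivalence relation $R$ on a graph $\Gamma$ is compatible if no vertex is equivalent to an edge, if $(e_1,e_2)\in R$ for edges implies $(s(e_1),s(e_2)),(t(e_1),t(e_2)),(\overline{e_1},\overline{e_2})\in R$, and $(e,\overline e)\notin R$ for all edges $e$; thus the set $\Gamma/R$ of classes is a graph. A cofinite graph is a graph with a Hausdorff uniformity in which every entourage contains a compatible cofinite entourage, i.e. an entourage that is a compatible equivalence relation with finitely many classes. A profinite graph is a compact cofinite graph (equivalently, an inverse limit of finite discrete graphs). It is connected if $\Gamma/R$ is path connected for every compatible cofinite entourage $R$. An inverse system of maps $(f_i\colon\Gamma_i\to\Delta_i,\phi_{ij},\psi_{ij})$ over a directed set $I$ consists of continuous maps of graphs $f_i$,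 and, for $j\ge i$, continuous maps of graphs $\phi_{ij}\colon\Gamma_j\to\Gamma_i$, $\psi_{ij}\colon\Delta_j\to\Delta_i$ forming inverse systems, with $f_i\phi_{ij}=\psi_{ij}f_j$. Its inverse limit is the induced continuous map $f\colon\varprojlim\Gamma_i\to\varprojlim\Delta_i$. A continuous map of profinite graphs is a covering if it is the inverse limit of an inverse system of locally bijective maps of finite discrete graphs. $\operatorname{Aut}(\Gamma,f)$ is the group, under composition, of all covering transformations, i.e. continuous maps of graphs $h\colon\Gamma\to\Gamma$ with continuous inverse and $fh=f$. An action of a group $G$ on a uniform space $X$ is uniformly equicontinuous if for each entourage $W$ of $X$ there is an entourage $V$ of $X$ with $(g\times g)[V]\subseteq W$ for all $g\in G$. The action is free if no nontrivial element fixes any element (vertex or edge) of $\Gamma$. The group $G=\operatorname{Aut}(\Gamma,f)$ carries the uniformity (group topology) induced by its action on $\Gamma$: a base of neighbourhoods of $1$ is given by the finite-index normal subgroups $N_R=\{g\in G\mid (gx,x)\in R\ \forall x\in\Gamma\}$, where $R$ runs over the $G$-invariant compatible cofinite entourages of $\Gamma$ (those with $(g\times g)[R]=R$ for all $g\in G$). *)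

theory Defs
  imports "HOL-Analysis.Analysis" "HOL-Algebra.Group_Action"
begin

section \<open>Graphs\<close>

text \<open>
  Vertices and edges live in one type, since a graph is a single set (with a single uniformity)
  that is the disjoint union of its vertices and edges. The maps \<open>src\<close>, \<open>tgt\<close> and \<open>flip\<close> are
  meaningful on edges only.
\<close>

record 'a graph =
  verts :: "'a set"
  edges :: "'a set"
  src :: "'a \<Rightarrow> 'a"
  tgt :: "'a \<Rightarrow> 'a"
  flip :: "'a \<Rightarrow> 'a"

definition elems :: "'a graph \<Rightarrow> 'a set" where
  "elems \<Gamma> = verts \<Gamma> \<union> edges \<Gamma>"

definition is_graph :: "'a graph \<Rightarrow> bool" where
  "is_graph \<Gamma> \<longleftrightarrow>
     verts \<Gamma> \<inter> edges \<Gamma> = {} \<and>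
     (\<forall>e\<in>edges \<Gamma>.
        src \<Gamma> e \<in> verts \<Gamma> \<and> tgt \<Gamma> e \<in> verts \<Gamma> \<and> flip \<Gamma> e \<in> edges \<Gamma> \<and>
        flip \<Gamma> (flip \<Gamma> e) = e \<and> flip \<Gamma> e \<noteq> e \<and>
        src \<Gamma> (flip \<Gamma> e) = tgt \<Gamma> e \<and> tgt \<Gamma> (flip \<Gamma> e) = src \<Gamma> e)"

definition graph_map :: "'a graph \<Rightarrow> 'b graph \<Rightarrow> ('a \<Rightarrow> 'b) \<Rightarrow> bool" where
  "graph_map \<Gamma> \<Delta> f \<longleftrightarrow>
     f \<in> verts \<Gamma> \<rightarrow> verts \<Delta> \<and> f \<in> edges \<Gamma> \<rightarrow> edges \<Delta> \<and>
     (\<forall>e\<in>edges \<Gamma>. f (src \<Gamma> e) = src \<Delta> (f e) \<and> f (tgt \<Gamma> e) = tgt \<Delta> (f e) \<and>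
                   f (flip \<Gamma> e) = flip \<Delta> (f e))"

definition locally_bijective :: "'a graph \<Rightarrow> 'b graph \<Rightarrow> ('a \<Rightarrow> 'b) \<Rightarrow> bool" where
  "locally_bijective \<Gamma> \<Delta> f \<longleftrightarrow>
     graph_map \<Gamma> \<Delta> f \<and>
     (\<forall>v\<in>verts \<Gamma>. bij_betw f {e \<in> edges \<Gamma>. src \<Gamma> e = v} {e \<in> edges \<Delta>. src \<Delta> e = f v})"

fun edge_path :: "'a graph \<Rightarrow> 'a \<Rightarrow> 'a list \<Rightarrow> 'a \<Rightarrow> bool" where
  "edge_path \<Gamma> u [] v \<longleftrightarrow> u = v"
| "edge_path \<Gamma> u (e # es) v \<longleftrightarrow> e \<in> edges \<Gamma> \<and> src \<Gamma> e = u \<and> edge_path \<Gamma> (tgt \<Gamma> e) es v"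

definition graph_path_connected :: "'a graph \<Rightarrow> bool" where
  "graph_path_connected \<Gamma> \<longleftrightarrow>
     elems \<Gamma> \<noteq> {} \<and> (\<forall>u\<in>verts \<Gamma>. \<forall>v\<in>verts \<Gamma>. \<exists>es. edge_path \<Gamma> u es v)"


section \<open>Cofinite and profinite graphs\<close>

definition compatible :: "'a graph \<Rightarrow> 'a rel \<Rightarrow> bool" where
  "compatible \<Gamma> R \<longleftrightarrow>
     equiv (elems \<Gamma>) R \<and>
     (\<forall>v\<in>verts \<Gamma>. \<forall>e\<in>edges \<Gamma>. (v, e) \<notin> R) \<and>
     (\<forall>e\<^sub>1\<in>edges \<Gamma>. \<forall>e\<^sub>2\<in>edges \<Gamma>. (e\<^sub>1, e\<^sub>2) \<in> R \<longrightarrow>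
        (src \<Gamma> e\<^sub>1, src \<Gamma> e\<^sub>2) \<in> R \<and> (tgt \<Gamma> e\<^sub>1, tgt \<Gamma> e\<^sub>2) \<in> R \<and> (flip \<Gamma> e\<^sub>1, flip \<Gamma> e\<^sub>2) \<in> R) \<and>
     (\<forall>e\<in>edges \<Gamma>. (e, flip \<Gamma> e) \<notin> R)"

definition quotient_graph :: "'a graph \<Rightarrow> 'a rel \<Rightarrow> 'a set graph" where
  "quotient_graph \<Gamma> R =
     \<lparr>verts = verts \<Gamma> // R,
      edges = edges \<Gamma> // R,
      src = (\<lambda>C. \<Union>e\<in>C. R `` {src \<Gamma> e}),
      tgt = (\<lambda>C. \<Union>e\<in>C. R `` {tgt \<Gamma> e}),
      flip = (\<lambda>C. \<Union>e\<in>C. R `` {flip \<Gamma> e})\<rparr>"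

definition entourage :: "('a::uniform_space \<times> 'a) set \<Rightarrow> bool" where
  "entourage W \<longleftrightarrow> (\<forall>\<^sub>F p in uniformity. p \<in> W)"

definition compatible_cofinite_entourage :: "'a::uniform_space graph \<Rightarrow> 'a rel \<Rightarrow> bool" where
  "compatible_cofinite_entourage \<Gamma> R \<longleftrightarrow>
     compatible \<Gamma> R \<and> entourage R \<and> finite (elems \<Gamma> // R)"

text \<open>
  The uniform space underlying a cofinite graph is the whole type, so that its uniformity is the
  one of the type class; the uniformity is Hausdorff iff the type is in class \<open>t2_space\<close>.
\<close>

definition cofinite_graph :: "'a::{uniform_space,t2_space} graph \<Rightarrow> bool" where
  "cofinite_graph \<Gamma> \<longleftrightarrow>
     is_graph \<Gamma> \<and> elems \<Gamma> = UNIV \<and>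
     (\<forall>W. entourage W \<longrightarrow> (\<exists>R. compatible_cofinite_entourage \<Gamma> R \<and> R \<subseteq> W))"

definition profinite_graph :: "'a::{uniform_space,t2_space} graph \<Rightarrow> bool" where
  "profinite_graph \<Gamma> \<longleftrightarrow> cofinite_graph \<Gamma> \<and> compact (UNIV :: 'a set)"

definition connected_cofinite_graph :: "'a::{uniform_space,t2_space} graph \<Rightarrow> bool" where
  "connected_cofinite_graph \<Gamma> \<longleftrightarrow>
     (\<forall>R. compatible_cofinite_entourage \<Gamma> R \<longrightarrow> graph_path_connected (quotient_graph \<Gamma> R))"


section \<open>Inverse limits and coverings\<close>

definition directed_set :: "'i set \<Rightarrow> ('i \<Rightarrow> 'i \<Rightarrow> bool) \<Rightarrow> bool" where
  "directed_set I leq \<longleftrightarrow>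
     I \<noteq> {} \<and>
     (\<forall>i\<in>I. leq i i) \<and>
     (\<forall>i\<in>I. \<forall>j\<in>I. \<forall>k\<in>I. leq i j \<longrightarrow> leq j k \<longrightarrow> leq i k) \<and>
     (\<forall>i\<in>I. \<forall>j\<in>I. \<exists>k\<in>I. leq i k \<and> leq j k)"

definition inverse_system_finite_graphs ::
  "'i set \<Rightarrow> ('i \<Rightarrow> 'i \<Rightarrow> bool) \<Rightarrow> ('i \<Rightarrow> 'c graph) \<Rightarrow> ('i \<Rightarrow> 'i \<Rightarrow> 'c \<Rightarrow> 'c) \<Rightarrow> bool" where
  "inverse_system_finite_graphs I leq G \<phi> \<longleftrightarrow>
     (\<forall>i\<in>I. is_graph (G i) \<and> finite (elems (G i))) \<and>
     (\<forall>i\<in>I. \<forall>j\<in>I. leq i j \<longrightarrow> graph_map (G j) (G i) (\<phi> i j)) \<and>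
     (\<forall>i\<in>I. \<forall>x\<in>elems (G i). \<phi> i i x = x) \<and>
     (\<forall>i\<in>I. \<forall>j\<in>I. \<forall>k\<in>I. leq i j \<longrightarrow> leq j k \<longrightarrow>
        (\<forall>x\<in>elems (G k). \<phi> i j (\<phi> j k x) = \<phi> i k x))"

definition inverse_system_locally_bijective ::
  "'i set \<Rightarrow> ('i \<Rightarrow> 'i \<Rightarrow> bool) \<Rightarrow> ('i \<Rightarrow> 'c graph) \<Rightarrow> ('i \<Rightarrow> 'd graph) \<Rightarrow> ('i \<Rightarrow> 'c \<Rightarrow> 'd) \<Rightarrow>
   ('i \<Rightarrow> 'i \<Rightarrow> 'c \<Rightarrow> 'c) \<Rightarrow> ('i \<Rightarrow> 'i \<Rightarrow> 'd \<Rightarrow> 'd) \<Rightarrow> bool" where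
  "inverse_system_locally_bijective I leq G D f \<phi> \<psi> \<longleftrightarrow>
     directed_set I leq \<and>
     inverse_system_finite_graphs I leq G \<phi> \<and>
     inverse_system_finite_graphs I leq D \<psi> \<and>
     (\<forall>i\<in>I. locally_bijective (G i) (D i) (f i)) \<and>
     (\<forall>i\<in>I. \<forall>j\<in>I. leq i j \<longrightarrow> (\<forall>x\<in>elems (G j). f i (\<phi> i j x) = \<psi> i j (f j x)))"

definition limit_graph ::
  "'i set \<Rightarrow> ('i \<Rightarrow> 'i \<Rightarrow> bool) \<Rightarrow> ('i \<Rightarrow> 'c graph) \<Rightarrow> ('i \<Rightarrow> 'i \<Rightarrow> 'c \<Rightarrow> 'c) \<Rightarrow> ('i \<Rightarrow> 'c) graph" where
  "limit_graph I leq G \<phi> =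
     \<lparr>verts = {x \<in> \<Pi>\<^sub>E i\<in>I. verts (G i). \<forall>i\<in>I. \<forall>j\<in>I. leq i j \<longrightarrow> \<phi> i j (x j) = x i},
      edges = {x \<in> \<Pi>\<^sub>E i\<in>I. edges (G i). \<forall>i\<in>I. \<forall>j\<in>I. leq i j \<longrightarrow> \<phi> i j (x j) = x i},
      src = (\<lambda>x. \<lambda>i\<in>I. src (G i) (x i)),
      tgt = (\<lambda>x. \<lambda>i\<in>I. tgt (G i) (x i)),
      flip = (\<lambda>x. \<lambda>i\<in>I. flip (G i) (x i))\<rparr>"

definition limit_topology ::
  "'i set \<Rightarrow> ('i \<Rightarrow> 'i \<Rightarrow> bool) \<Rightarrow> ('i \<Rightarrow> 'c graph) \<Rightarrow> ('i \<Rightarrow> 'i \<Rightarrow> 'c \<Rightarrow> 'c) \<Rightarrow> ('i \<Rightarrow> 'c) topology" where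
  "limit_topology I leq G \<phi> =
     subtopology (product_topology (\<lambda>i. discrete_topology (elems (G i))) I)
       (elems (limit_graph I leq G \<phi>))"

text \<open>A graph map that is bijective on elements is an isomorphism of graphs.\<close>

definition topological_graph_iso ::
  "'a::topological_space graph \<Rightarrow> 'b graph \<Rightarrow> 'b topology \<Rightarrow> ('a \<Rightarrow> 'b) \<Rightarrow> bool" where
  "topological_graph_iso \<Gamma> \<Lambda> T a \<longleftrightarrow>
     graph_map \<Gamma> \<Lambda> a \<and>
     homeomorphic_map (subtopology euclidean (elems \<Gamma>)) T a \<and> topspace T = elems \<Lambda>"

text \<open>
  \<open>f\<close> is, up to isomorphism of topological graphs, the limit of an inverse system of locally
  bijective maps \<open>F i : G i \<rightarrow> D i\<close> of finite discrete graphs, with transition maps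
  \<open>\<phi> i j : G j \<rightarrow> G i\<close> and \<open>\<psi> i j : D j \<rightarrow> D i\<close> for \<open>leq i j\<close>. As one cannot quantify
  existentially over types, the types of indices and of elements of the finite graphs are
  parameters. A theorem that assumes \<open>covering\<close> with type variables in their place
  applies to inverse systems over arbitrary types.
\<close>

definition covering ::
  "'i itself \<Rightarrow> 'c itself \<Rightarrow> 'd itself \<Rightarrow>
   'a::{uniform_space,t2_space} graph \<Rightarrow> 'b::{uniform_space,t2_space} graph \<Rightarrow> ('a \<Rightarrow> 'b) \<Rightarrow> bool" where
  "covering TI TC TD \<Gamma> \<Delta> f \<longleftrightarrow>
     profinite_graph \<Gamma> \<and> profinite_graph \<Delta> \<and>
     graph_map \<Gamma> \<Delta> f \<and> continuous_on UNIV f \<and>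
     (\<exists>(I :: 'i set) leq (G :: 'i \<Rightarrow> 'c graph) (D :: 'i \<Rightarrow> 'd graph) F \<phi> \<psi> a b.
        inverse_system_locally_bijective I leq G D F \<phi> \<psi> \<and>
        topological_graph_iso \<Gamma> (limit_graph I leq G \<phi>) (limit_topology I leq G \<phi>) a \<and>
        topological_graph_iso \<Delta> (limit_graph I leq D \<psi>) (limit_topology I leq D \<psi>) b \<and>
        (\<forall>x. b (f x) = (\<lambda>i\<in>I. F i (a x i))))"


section \<open>Group actions\<close>

definition free_action :: "('g, 'm) monoid_scheme \<Rightarrow> 'a set \<Rightarrow> ('g \<Rightarrow> 'a \<Rightarrow> 'a) \<Rightarrow> bool" where
  "free_action G X act \<longleftrightarrow> (\<forall>g\<in>carrier G. g \<noteq> \<one>\<^bsub>G\<^esub> \<longrightarrow> (\<forall>x\<in>X. act g x \<noteq> x))"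

definition uniformly_equicontinuous_action ::
  "('g, 'm) monoid_scheme \<Rightarrow> ('g \<Rightarrow> 'a::uniform_space \<Rightarrow> 'a) \<Rightarrow> bool" where
  "uniformly_equicontinuous_action G act \<longleftrightarrow>
     (\<forall>W. entourage W \<longrightarrow>
        (\<exists>V. entourage V \<and> (\<forall>g\<in>carrier G. map_prod (act g) (act g) ` V \<subseteq> W)))"

definition invariant_entourage ::
  "'a::uniform_space graph \<Rightarrow> ('g, 'm) monoid_scheme \<Rightarrow> ('g \<Rightarrow> 'a \<Rightarrow> 'a) \<Rightarrow> 'a rel \<Rightarrow> bool" where
  "invariant_entourage \<Gamma> G act R \<longleftrightarrow>
     compatible_cofinite_entourage \<Gamma> R \<and> (\<forall>g\<in>carrier G. map_prod (act g) (act g) ` R = R)"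

definition entourage_subgroup ::
  "'a graph \<Rightarrow> ('g, 'm) monoid_scheme \<Rightarrow> ('g \<Rightarrow> 'a \<Rightarrow> 'a) \<Rightarrow> 'a rel \<Rightarrow> 'g set" where
  "entourage_subgroup \<Gamma> G act R = {g \<in> carrier G. \<forall>x\<in>elems \<Gamma>. (act g x, x) \<in> R}"

text \<open>
  The group topology with the subgroups \<open>entourage_subgroup \<Gamma> G act R\<close>, for invariant \<open>R\<close>, as a
  base of neighbourhoods of \<open>\<one>\<close>. Its underlying set is the whole group only if there is
  at least one invariant \<open>R\<close>.
\<close>

definition action_topology ::
  "'a::uniform_space graph \<Rightarrow> ('g, 'm) monoid_scheme \<Rightarrow> ('g \<Rightarrow> 'a \<Rightarrow> 'a) \<Rightarrow> 'g topology" where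
  "action_topology \<Gamma> G act = topology (\<lambda>U. U \<subseteq> carrier G \<and>
     (\<forall>g\<in>U. \<exists>R. invariant_entourage \<Gamma> G act R \<and> g <#\<^bsub>G\<^esub> entourage_subgroup \<Gamma> G act R \<subseteq> U))"

lemma compatible_cofinite_entourage_Int:
  assumes "compatible_cofinite_entourage \<Gamma> R" "compatible_cofinite_entourage \<Gamma> S"
  shows "compatible_cofinite_entourage \<Gamma> (R \<inter> S)"
proof -
  have eqv: "equiv (elems \<Gamma>) R" "equiv (elems \<Gamma>) S"
    using assms by (auto simp: compatible_cofinite_entourage_def compatible_def)
  have "equiv (elems \<Gamma>) (R \<inter> S)"
    using eqv unfolding equiv_def refl_on_def sym_def trans_def by blast
  hence "compatible \<Gamma> (R \<inter> S)"
    using assms unfolding compatible_cofinite_entourage_def compatible_def by blast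
  moreover have "entourage (R \<inter> S)"
    using assms by (auto simp: compatible_cofinite_entourage_def entourage_def eventually_conj_iff)
  moreover have "elems \<Gamma> // (R \<inter> S) \<subseteq> (\<lambda>(A, B). A \<inter> B) ` ((elems \<Gamma> // R) \<times> (elems \<Gamma> // S))"
  proof
    fix C assume "C \<in> elems \<Gamma> // (R \<inter> S)"
    then obtain x where x: "x \<in> elems \<Gamma>" "C = (R \<inter> S) `` {x}" by (auto elim: quotientE)
    hence "C = (\<lambda>(A, B). A \<inter> B) (R `` {x}, S `` {x})" by auto
    moreover have "(R `` {x}, S `` {x}) \<in> (elems \<Gamma> // R) \<times> (elems \<Gamma> // S)"
      using x by (auto intro: quotientI)
    ultimately show "C \<in> (\<lambda>(A, B). A \<inter> B) ` ((elems \<Gamma> // R) \<times> (elems \<Gamma> // S))" by (rule image_eqI)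
  qed
  hence "finite (elems \<Gamma> // (R \<inter> S))"
    using assms by (auto simp: compatible_cofinite_entourage_def intro: finite_subset)
  ultimately show ?thesis
    by (simp add: compatible_cofinite_entourage_def)
qed

lemma openin_action_topology:
  assumes inj: "\<And>g. g \<in> carrier G \<Longrightarrow> inj (act g)"
  shows "openin (action_topology \<Gamma> G act) U \<longleftrightarrow> U \<subseteq> carrier G \<and>
    (\<forall>g\<in>U. \<exists>R. invariant_entourage \<Gamma> G act R \<and> g <#\<^bsub>G\<^esub> entourage_subgroup \<Gamma> G act R \<subseteq> U)"
proof -
  let ?P = "\<lambda>U. U \<subseteq> carrier G \<and>
    (\<forall>g\<in>U. \<exists>R. invariant_entourage \<Gamma> G act R \<and> g <#\<^bsub>G\<^esub> entourage_subgroup \<Gamma> G act R \<subseteq> U)"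
  have inv: "invariant_entourage \<Gamma> G act (R \<inter> S)"
    if "invariant_entourage \<Gamma> G act R" "invariant_entourage \<Gamma> G act S" for R S
    unfolding invariant_entourage_def
  proof (intro conjI ballI)
    show "compatible_cofinite_entourage \<Gamma> (R \<inter> S)"
      using that compatible_cofinite_entourage_Int by (auto simp: invariant_entourage_def)
  next
    fix g assume g: "g \<in> carrier G"
    have "inj (map_prod (act g) (act g))"
      using inj[OF g] by (simp add: prod.inj_map)
    thus "map_prod (act g) (act g) ` (R \<inter> S) = R \<inter> S"
      using that g by (simp add: image_Int invariant_entourage_def)
  qed
  have sub: "g <#\<^bsub>G\<^esub> entourage_subgroup \<Gamma> G act (R \<inter> S) \<subseteq>
      (g <#\<^bsub>G\<^esub> entourage_subgroup \<Gamma> G act R) \<inter> (g <#\<^bsub>G\<^esub> entourage_subgroup \<Gamma> G act S)" for g R S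
    by (auto simp: l_coset_def entourage_subgroup_def)
  have "istopology ?P"
    unfolding istopology_def
  proof (intro conjI allI impI)
    fix U V assume U: "?P U" and V: "?P V"
    show "U \<inter> V \<subseteq> carrier G" using U by blast
    show "\<forall>g\<in>U \<inter> V. \<exists>R. invariant_entourage \<Gamma> G act R \<and>
        g <#\<^bsub>G\<^esub> entourage_subgroup \<Gamma> G act R \<subseteq> U \<inter> V"
    proof
      fix g assume "g \<in> U \<inter> V"
      then obtain R S where R: "invariant_entourage \<Gamma> G act R" "g <#\<^bsub>G\<^esub> entourage_subgroup \<Gamma> G act R \<subseteq> U"
        and S: "invariant_entourage \<Gamma> G act S" "g <#\<^bsub>G\<^esub> entourage_subgroup \<Gamma> G act S \<subseteq> V"
        using U V by blast
      show "\<exists>R. invariant_entourage \<Gamma> G act R \<and> g <#\<^bsub>G\<^esub> entourage_subgroup \<Gamma> G act R \<subseteq> U \<inter> V"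
        using inv[OF R(1) S(1)] sub[of g R S] R(2) S(2) by blast
    qed
  next
    fix K assume K: "\<forall>U\<in>K. ?P U"
    show "\<Union> K \<subseteq> carrier G" using K by blast
    show "\<forall>g\<in>\<Union> K. \<exists>R. invariant_entourage \<Gamma> G act R \<and>
        g <#\<^bsub>G\<^esub> entourage_subgroup \<Gamma> G act R \<subseteq> \<Union> K"
      using K by (meson Union_iff Union_upper subset_trans)
  qed
  thus ?thesis
    by (simp add: action_topology_def topology_inverse')
qed


section \<open>Profinite groups\<close>

definition topological_group :: "('g, 'm) monoid_scheme \<Rightarrow> 'g topology \<Rightarrow> bool" where
  "topological_group G T \<longleftrightarrow>
     group G \<and> topspace T = carrier G \<and>
     continuous_map (prod_topology T T) T (\<lambda>(x, y). x \<otimes>\<^bsub>G\<^esub> y) \<and>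
     continuous_map T T (\<lambda>x. inv\<^bsub>G\<^esub> x)"

text \<open>As for graphs, profinite means compact (Hausdorff) cofinite.\<close>

definition cofinite_group :: "('g, 'm) monoid_scheme \<Rightarrow> 'g topology \<Rightarrow> bool" where
  "cofinite_group G T \<longleftrightarrow>
     topological_group G T \<and> Hausdorff_space T \<and>
     (\<forall>U. openin T U \<and> \<one>\<^bsub>G\<^esub> \<in> U \<longrightarrow>
        (\<exists>N. N \<lhd> G \<and> finite (rcosets\<^bsub>G\<^esub> N) \<and> openin T N \<and> N \<subseteq> U))"

definition profinite_group :: "('g, 'm) monoid_scheme \<Rightarrow> 'g topology \<Rightarrow> bool" where
  "profinite_group G T \<longleftrightarrow> cofinite_group G T \<and> compact_space T"

lemma cofinite_group_totally_disconnected: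
  assumes G: "cofinite_group G T" and S: "connectedin T S" and "x \<in> S" "y \<in> S"
  shows "x = y"
proof (rule ccontr)
  assume "x \<noteq> y"
  interpret group G using G by (simp add: cofinite_group_def topological_group_def)
  have top: "topspace T = carrier G"
    and mul: "continuous_map (prod_topology T T) T (\<lambda>(x, y). x \<otimes>\<^bsub>G\<^esub> y)"
    using G by (auto simp: cofinite_group_def topological_group_def)
  have SG: "S \<subseteq> carrier G" using connectedin_subset_topspace[OF S] top by simp
  have x: "x \<in> carrier G" and y: "y \<in> carrier G" using SG assms by auto
  define z where "z = inv\<^bsub>G\<^esub> x \<otimes>\<^bsub>G\<^esub> y"
  have z: "z \<in> carrier G" "z \<noteq> \<one>\<^bsub>G\<^esub>"
  proof -
    show "z \<in> carrier G" using x y by (simp add: z_def)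
    show "z \<noteq> \<one>\<^bsub>G\<^esub>"
    proof
      assume "z = \<one>\<^bsub>G\<^esub>"
      hence "x \<otimes>\<^bsub>G\<^esub> (inv\<^bsub>G\<^esub> x \<otimes>\<^bsub>G\<^esub> y) = x" using x by (simp add: z_def)
      thus False using x y \<open>x \<noteq> y\<close> by (simp add: m_assoc[symmetric])
    qed
  qed
  obtain U V where UV: "openin T U" "openin T V" "\<one>\<^bsub>G\<^esub> \<in> U" "z \<in> V" "disjnt U V"
    using G z top unfolding cofinite_group_def Hausdorff_space_def by (metis one_closed)
  then obtain N where N: "N \<lhd> G" "openin T N" "N \<subseteq> U"
    using G unfolding cofinite_group_def by metis
  have sub: "subgroup N G" using N(1) by (rule normal_imp_subgroup)
  have zN: "z \<notin> N" using UV N unfolding disjnt_def by auto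
  have trans: "continuous_map T T (\<lambda>w. g \<otimes>\<^bsub>G\<^esub> w)" if "g \<in> carrier G" for g
  proof -
    have "continuous_map T (prod_topology T T) (\<lambda>w. (g, w))"
      using that top by (simp add: continuous_map_pairwise comp_def)
    from continuous_map_compose[OF this mul] show ?thesis by (simp add: comp_def)
  qed
  have coset: "openin T {w \<in> carrier G. inv\<^bsub>G\<^esub> g \<otimes>\<^bsub>G\<^esub> w \<in> N}" if "g \<in> carrier G" for g
    using openin_continuous_map_preimage[OF trans[OF inv_closed[OF that]] N(2)] top by simp
  let ?A = "{w \<in> carrier G. inv\<^bsub>G\<^esub> x \<otimes>\<^bsub>G\<^esub> w \<in> N}"
  let ?B = "\<Union>g\<in>carrier G - ?A. {w \<in> carrier G. inv\<^bsub>G\<^esub> g \<otimes>\<^bsub>G\<^esub> w \<in> N}"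
  have oA: "openin T ?A" using coset[OF x] .
  have oB: "openin T ?B" using coset by blast
  have gB: "g \<in> ?B" if "g \<in> carrier G - ?A" for g
    using that subgroup.one_closed[OF sub] by (auto intro!: bexI[of _ g])
  have dis: "?A \<inter> ?B = {}"
  proof (rule ccontr)
    assume "?A \<inter> ?B \<noteq> {}"
    then obtain w g where w: "w \<in> carrier G" "inv\<^bsub>G\<^esub> x \<otimes>\<^bsub>G\<^esub> w \<in> N" "inv\<^bsub>G\<^esub> g \<otimes>\<^bsub>G\<^esub> w \<in> N"
      and g: "g \<in> carrier G" "inv\<^bsub>G\<^esub> x \<otimes>\<^bsub>G\<^esub> g \<notin> N" by blast
    have "(inv\<^bsub>G\<^esub> x \<otimes>\<^bsub>G\<^esub> w) \<otimes>\<^bsub>G\<^esub> inv\<^bsub>G\<^esub> (inv\<^bsub>G\<^esub> g \<otimes>\<^bsub>G\<^esub> w) \<in> N"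
      using w subgroup.m_closed[OF sub] subgroup.m_inv_closed[OF sub] by blast
    also have "(inv\<^bsub>G\<^esub> x \<otimes>\<^bsub>G\<^esub> w) \<otimes>\<^bsub>G\<^esub> inv\<^bsub>G\<^esub> (inv\<^bsub>G\<^esub> g \<otimes>\<^bsub>G\<^esub> w) = inv\<^bsub>G\<^esub> x \<otimes>\<^bsub>G\<^esub> g"
    proof -
      have "w \<otimes>\<^bsub>G\<^esub> (inv\<^bsub>G\<^esub> w \<otimes>\<^bsub>G\<^esub> g) = g"
        using w g by (simp add: m_assoc[symmetric])
      thus ?thesis using x w g by (simp add: inv_mult_group m_assoc)
    qed
    finally show False using g by simp
  qed
  have "S \<subseteq> ?A \<union> ?B" using SG gB by blast
  moreover have "?A \<inter> S \<noteq> {}"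
    using \<open>x \<in> S\<close> x subgroup.one_closed[OF sub] by auto
  moreover have "?B \<inter> S \<noteq> {}"
    using \<open>y \<in> S\<close> y gB[of y] zN by (auto simp: z_def)
  ultimately show False
    using S oA oB dis unfolding connectedin by (metis (no_types, lifting) inf_bot_left)
qed


section \<open>Covering transformations\<close>

definition covering_transformations ::
  "'a::topological_space graph \<Rightarrow> ('a \<Rightarrow> 'b) \<Rightarrow> ('a \<Rightarrow> 'a) set" where
  "covering_transformations \<Gamma> f =
     {h. graph_map \<Gamma> \<Gamma> h \<and> (\<exists>k. homeomorphism UNIV UNIV h k) \<and> f \<circ> h = f}"

definition Aut :: "'a::topological_space graph \<Rightarrow> ('a \<Rightarrow> 'b) \<Rightarrow> ('a \<Rightarrow> 'a) monoid" where
  "Aut \<Gamma> f = \<lparr>carrier = covering_transformations \<Gamma> f, mult = (\<circ>), one = id\<rparr>"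

end

theory Submission
  imports Defs
begin

text \<open>
  Two lifts of \<open>f\<close> to a finite stage \<open>G i\<close> that agree at one point are equal: they factor through a
  finite quotient of \<open>\<Gamma>\<close>, which is path connected, and locally bijective maps lift paths uniquely.
  Hence the maps \<open>a i \<circ> g\<close>, for \<open>g\<close> in the group, are determined by their value at one point, and
  so there are only finitely many of them. The intersection \<open>R\<close> of their kernels is therefore an
  entourage. It is invariant and is contained in the kernel of \<open>a i\<close>, so these relations form a base
  of the uniformity, which is equicontinuity; moreover \<open>(g x, x) \<in> R\<close> for one \<open>x\<close> implies it for
  all \<open>x\<close>, whence freeness. Given invariant entourages, the covering transformations are cut out by
  closed conditions in the compact space of all maps \<open>\<Gamma> \<rightarrow> \<Gamma>\<close> with pointwise convergence, which
  induces the group topology; so the group is compact.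
\<close>

section \<open>Equivalence relations that are entourages\<close>

text \<open>By transitivity, all points \<open>R\<close>-close to a member of the class stay in the
  class, so the class is a neighbourhood of each of its members.\<close>

lemma open_entourage_class:
  fixes R :: "'a::uniform_space rel"
  assumes "equiv UNIV R" "entourage R"
  shows "open (R `` {x})"
  unfolding open_uniformity
proof
  fix y assume "y \<in> R `` {x}"
  hence xy: "(x, y) \<in> R" by simp
  have "trans R" using assms(1) by (simp add: equiv_def)
  have "\<forall>\<^sub>F p in uniformity. p \<in> R" using assms(2) by (simp add: entourage_def)
  thus "\<forall>\<^sub>F (x', z) in uniformity. x' = y \<longrightarrow> z \<in> R `` {x}"
    by eventually_elim (use xy \<open>trans R\<close> in \<open>auto dest: transD\<close>)
qed

lemma open_separates_entourage:
  fixes x :: "'a::uniform_space"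
  assumes "open U" "x \<in> U"
  obtains W where "entourage W" "W `` {x} \<subseteq> U"
proof
  \<comment> \<open>The witness restricts only the pairs that start at \<open>x\<close>; that it is
    an entourage is the uniform description of \<open>U\<close> being a neighbourhood of
    \<open>x\<close>.\<close>
  show "entourage {(a, b). a = x \<longrightarrow> b \<in> U}"
    using assms unfolding entourage_def open_uniformity
    by (auto elim: eventually_mono)
qed auto

lemma entourage_separates:
  fixes x :: "'a::{uniform_space,t2_space}"
  assumes "x \<noteq> y"
  obtains W where "entourage W" "(x, y) \<notin> W"
proof -
  have "open (- {y})" "x \<in> - {y}" using assms by auto
  then obtain W where "entourage W" "W `` {x} \<subseteq> - {y}" by (rule open_separates_entourage)
  thus ?thesis using that by blast
qed

lemma entourage_mono: "entourage V \<Longrightarrow> V \<subseteq> W \<Longrightarrow> entourage W"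
  unfolding entourage_def by (auto elim: eventually_mono)

lemma entourage_INT:
  assumes "finite S" "\<And>s. s \<in> S \<Longrightarrow> entourage (W s)"
  shows "entourage (\<Inter>s\<in>S. W s)"
  using assms eventually_ball_finite[of S "\<lambda>p s. p \<in> W s" uniformity]
  by (simp add: entourage_def)

text \<open>The classes are open and cover a compact space; a finite subcover already contains every
  class, since classes that meet coincide.\<close>

lemma compact_finite_quotient:
  fixes R :: "'a::uniform_space rel"
  assumes "compact (UNIV :: 'a set)" "equiv UNIV R" "entourage R"
  shows "finite (UNIV // R)"
proof -
  have "UNIV \<subseteq> (\<Union>x\<in>UNIV. R `` {x})" using assms(2) by (auto simp: equiv_def refl_on_def)
  with open_entourage_class[OF assms(2,3)]
  obtain X where X: "finite X" "UNIV \<subseteq> (\<Union>x\<in>X. R `` {x})"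
    by (rule compactE_image[OF assms(1)])
  have "UNIV // R \<subseteq> (\<lambda>x. R `` {x}) ` X"
  proof
    fix C assume "C \<in> UNIV // R"
    then obtain y where y: "C = R `` {y}" by (auto elim: quotientE)
    obtain x where "x \<in> X" "(x, y) \<in> R" using X(2) by blast
    hence "C = R `` {x}" using y equiv_class_eq[OF assms(2)] by metis
    thus "C \<in> (\<lambda>x. R `` {x}) ` X" using \<open>x \<in> X\<close> by blast
  qed
  thus ?thesis using X(1) finite_surj by blast
qed

lemma finite_representatives:
  fixes R :: "'a::uniform_space rel"
  assumes "compact (UNIV :: 'a set)" "equiv UNIV R" "entourage R"
  obtains X where "finite X" "\<forall>y. \<exists>x\<in>X. (x, y) \<in> R"
proof -
  have "finite (UNIV // R)" by (rule compact_finite_quotient[OF assms])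
  hence "finite ((\<lambda>C. SOME x. x \<in> C) ` (UNIV // R))" by simp
  moreover have "\<exists>x\<in>(\<lambda>C. SOME x. x \<in> C) ` (UNIV // R). (x, y) \<in> R" for y
  proof -
    have "y \<in> R `` {y}" using assms(2) by (auto simp: equiv_def refl_on_def)
    hence "(SOME x. x \<in> R `` {y}) \<in> R `` {y}" by (rule someI)
    hence "((SOME x. x \<in> R `` {y}), y) \<in> R" using assms(2) by (auto simp: equiv_def dest: symD)
    moreover have "(SOME x. x \<in> R `` {y}) \<in> (\<lambda>C. SOME x. x \<in> C) ` (UNIV // R)"
      by (rule imageI) (simp add: quotientI)
    ultimately show ?thesis by blast
  qed
  ultimately show ?thesis using that by blast
qed

text \<open>A condition invariant under \<open>R\<close> in both variables is a union of products of
  \<open>R\<close>-classes, and these are open. This is the source of all open and closed sets of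
  pairs below.\<close>

lemma open_saturated:
  fixes R :: "'a::uniform_space rel"
  assumes R: "equiv UNIV R" "entourage R"
    and sat: "\<And>x y x' y'. Q x y \<Longrightarrow> (x, x') \<in> R \<Longrightarrow> (y, y') \<in> R \<Longrightarrow> Q x' y'"
  shows "open {(x, y). Q x y}"
proof (rule topological_space_class.openI)
  fix p assume "p \<in> {(x, y). Q x y}"
  then obtain x y where p: "p = (x, y)" "Q x y" by (cases p) auto
  have "x \<in> R `` {x}" "y \<in> R `` {y}" using R(1) by (auto simp: equiv_def refl_on_def)
  hence "p \<in> R `` {x} \<times> R `` {y}" using p(1) by simp
  moreover have "open (R `` {x} \<times> R `` {y})"
    by (intro open_Times open_entourage_class R)
  moreover have "R `` {x} \<times> R `` {y} \<subseteq> {(x, y). Q x y}" using sat p(2) by auto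
  ultimately show "\<exists>T. open T \<and> p \<in> T \<and> T \<subseteq> {(x, y). Q x y}" by blast
qed

text \<open>Compactness makes local constancy uniform. Each \<open>x\<close> has an equivalence
  entourage \<open>R x\<close> whose class at \<open>x\<close> lies in a fibre of \<open>q\<close>;
  finitely many of these classes cover the space, and the intersection of the corresponding
  \<open>R x\<close> lies in the kernel.\<close>

lemma kernel_entourage:
  fixes \<Gamma> :: "'a::{uniform_space,t2_space} graph" and q :: "'a \<Rightarrow> 'c"
  assumes "profinite_graph \<Gamma>" and op: "\<And>c. open {x. q x = c}"
  shows "entourage {(x, y). q x = q y}"
proof -
  have cof: "cofinite_graph \<Gamma>" and cpt: "compact (UNIV :: 'a set)"
    using assms(1) by (auto simp: profinite_graph_def)
  have un: "elems \<Gamma> = UNIV" using cof by (simp add: cofinite_graph_def)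
  have "\<exists>R. equiv UNIV R \<and> entourage R \<and> R `` {x} \<subseteq> {y. q y = q x}" for x
  proof -
    obtain W where W: "entourage W" "W `` {x} \<subseteq> {y. q y = q x}"
      using open_separates_entourage[OF op[of "q x"], of x] by auto
    obtain R where "compatible_cofinite_entourage \<Gamma> R" "R \<subseteq> W"
      using cof W(1) unfolding cofinite_graph_def by blast
    thus ?thesis using W(2) un
      by (intro exI[of _ R]) (auto simp: compatible_cofinite_entourage_def compatible_def)
  qed
  then obtain R where R: "\<And>x. equiv UNIV (R x)" "\<And>x. entourage (R x)"
    "\<And>x. R x `` {x} \<subseteq> {y. q y = q x}" by metis
  have "UNIV \<subseteq> (\<Union>x\<in>UNIV. R x `` {x})" using R(1) by (auto simp: equiv_def refl_on_def)
  with open_entourage_class[OF R(1,2)]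
  obtain X where X: "finite X" "UNIV \<subseteq> (\<Union>x\<in>X. R x `` {x})"
    by (rule compactE_image[OF cpt])
  have "entourage (\<Inter>x\<in>X. R x)" using X(1) R(2) by (rule entourage_INT)
  moreover have "(\<Inter>x\<in>X. R x) \<subseteq> {(x, y). q x = q y}"
  proof clarify
    fix y z assume yz: "(y, z) \<in> (\<Inter>x\<in>X. R x)"
    obtain x where x: "x \<in> X" "(x, y) \<in> R x" using X(2) by blast
    moreover have "(x, z) \<in> R x" using x yz R(1)[of x] by (auto simp: equiv_def dest: transD)
    ultimately have "q y = q x" "q z = q x" using R(3)[of x] by blast+
    thus "q y = q z" by simp
  qed
  ultimately show ?thesis by (rule entourage_mono)
qed

section \<open>Uniqueness of lifts\<close>

lemma graph_map_comp:
  assumes "graph_map \<Gamma> \<Delta> g" "graph_map \<Delta> \<Lambda> h"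
  shows "graph_map \<Gamma> \<Lambda> (\<lambda>x. h (g x))"
  using assms unfolding graph_map_def by (auto simp: Pi_iff)

lemma graph_map_elems: "graph_map \<Gamma> \<Delta> g \<Longrightarrow> x \<in> elems \<Gamma> \<Longrightarrow> g x \<in> elems \<Delta>"
  unfolding graph_map_def elems_def by auto

text \<open>The common kernel \<open>K\<close> of \<open>g\<close> and \<open>h\<close> is a
  compatible cofinite entourage, so both maps descend to the path connected graph
  \<open>\<Gamma>/K\<close>. Agreement passes from the source of an edge to the edge because
  \<open>F\<close> is injective on the edges leaving a vertex, and then to its target.\<close>

lemma lift_unique:
  fixes \<Gamma> :: "'a::{uniform_space,t2_space} graph"
  assumes \<Gamma>: "profinite_graph \<Gamma>" "connected_cofinite_graph \<Gamma>"
    and \<Lambda>: "is_graph \<Lambda>" and F: "locally_bijective \<Lambda> \<Omega> F"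
    and g: "graph_map \<Gamma> \<Lambda> g" "\<And>c. open {x. g x = c}"
    and h: "graph_map \<Gamma> \<Lambda> h" "\<And>c. open {x. h x = c}"
    and lift: "\<And>x. F (g x) = F (h x)"
    and x: "g x = h x"
  shows "g = h"
proof -
  have un: "elems \<Gamma> = UNIV" and gr: "is_graph \<Gamma>"
    using \<Gamma>(1) by (auto simp: profinite_graph_def cofinite_graph_def)
  define K where "K = {(x, y). (g x, h x) = (g y, h y)}"
  have op: "open {x. (g x, h x) = c}" for c
  proof -
    have "{x. (g x, h x) = c} = {x. g x = fst c} \<inter> {x. h x = snd c}" by auto
    thus ?thesis using g(2) h(2) by (simp add: open_Int)
  qed
  have entK: "entourage K" unfolding K_def by (rule kernel_entourage[OF \<Gamma>(1) op])
  have eqK: "equiv UNIV K" unfolding K_def equiv_def refl_on_def sym_def trans_def by auto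
  have flip: "g e \<noteq> g (flip \<Gamma> e)" if "e \<in> edges \<Gamma>" for e
  proof -
    have "g e \<in> edges \<Lambda>" "g (flip \<Gamma> e) = flip \<Lambda> (g e)"
      using that g(1) by (auto simp: graph_map_def)
    thus ?thesis using \<Lambda> by (metis is_graph_def)
  qed
  have VE: "g v \<noteq> g e" if "v \<in> verts \<Gamma>" "e \<in> edges \<Gamma>" for v e
  proof -
    have "g v \<in> verts \<Lambda>" "g e \<in> edges \<Lambda>" using that g(1) by (auto simp: graph_map_def)
    thus ?thesis using \<Lambda> by (auto simp: is_graph_def)
  qed
  have stK: "(src \<Gamma> d, src \<Gamma> d') \<in> K \<and> (tgt \<Gamma> d, tgt \<Gamma> d') \<in> K \<and> (flip \<Gamma> d, flip \<Gamma> d') \<in> K"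
    if "d \<in> edges \<Gamma>" "d' \<in> edges \<Gamma>" "(d, d') \<in> K" for d d'
    using that g(1) h(1) unfolding K_def graph_map_def by auto
  have "compatible \<Gamma> K"
    unfolding compatible_def un
  proof (intro conjI ballI impI)
    show "equiv UNIV K" by (rule eqK)
    show "(v, e) \<notin> K" if "v \<in> verts \<Gamma>" "e \<in> edges \<Gamma>" for v e
      using VE[OF that] by (simp add: K_def)
    show "(e, flip \<Gamma> e) \<notin> K" if "e \<in> edges \<Gamma>" for e
      using flip[OF that] by (simp add: K_def)
  qed (use stK in blast)+
  hence "compatible_cofinite_entourage \<Gamma> K"
    using entK un compact_finite_quotient[OF _ eqK entK] \<Gamma>(1)
    by (simp add: compatible_cofinite_entourage_def profinite_graph_def)
  hence conn: "graph_path_connected (quotient_graph \<Gamma> K)"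
    using \<Gamma>(2) by (simp add: connected_cofinite_graph_def)
  have edge: "g e = h e" if e: "e \<in> edges \<Gamma>" "g (src \<Gamma> e) = h (src \<Gamma> e)" for e
  proof -
    have "src \<Gamma> e \<in> verts \<Gamma>" using gr e(1) by (simp add: is_graph_def)
    hence "g (src \<Gamma> e) \<in> verts \<Lambda>" using g(1) by (auto simp: graph_map_def)
    hence "inj_on F {d \<in> edges \<Lambda>. src \<Lambda> d = g (src \<Gamma> e)}"
      using F by (auto simp: locally_bijective_def bij_betw_def)
    moreover have "g e \<in> {d \<in> edges \<Lambda>. src \<Lambda> d = g (src \<Gamma> e)}"
      "h e \<in> {d \<in> edges \<Lambda>. src \<Lambda> d = g (src \<Gamma> e)}"
      using g(1) h(1) e by (auto simp: graph_map_def)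
    ultimately show ?thesis using lift[of e] by (auto dest: inj_onD)
  qed
  \<comment> \<open>The maps of \<open>quotient_graph\<close> are unions over all members of a
    class. Since equivalent members have equivalent images, the union collapses to a single
    class.\<close>
  have classes: "\<Union> ((\<lambda>e. K `` {s e}) ` (K `` {d})) = K `` {s d}"
    if "\<And>d'. (d, d') \<in> K \<Longrightarrow> (s d, s d') \<in> K" for s d
  proof -
    have "K `` {s d'} = K `` {s d}" if "d' \<in> K `` {d}" for d'
      using that \<open>\<And>d'. (d, d') \<in> K \<Longrightarrow> (s d, s d') \<in> K\<close> equiv_class_eq[OF eqK] by blast
    moreover have "d \<in> K `` {d}" using eqK by (auto simp: equiv_def refl_on_def)
    ultimately show ?thesis by blast
  qed
  have Kedge: "d' \<in> edges \<Gamma>" if "d \<in> edges \<Gamma>" "(d, d') \<in> K" for d d'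
    using that VE[of d' d] un by (auto simp: K_def elems_def)
  \<comment> \<open>Representatives of consecutive edges of a path in the quotient need not meet in
    \<open>\<Gamma>\<close>; their endpoints only agree modulo \<open>K\<close>. This suffices,
    because \<open>g\<close> and \<open>h\<close> are constant on the classes of
    \<open>K\<close>.\<close>
  have path: "g v = h v" if "edge_path (quotient_graph \<Gamma> K) (K `` {u}) es (K `` {v})" "g u = h u" for u v es
    using that
  proof (induction es arbitrary: u)
    case Nil
    hence "(u, v) \<in> K" using eq_equiv_class[OF _ eqK] by simp
    thus ?case using Nil.prems(2) by (auto simp: K_def)
  next
    case (Cons e es)
    have "e \<in> edges \<Gamma> // K" using Cons.prems(1) by (simp add: quotient_graph_def)
    then obtain d where d: "d \<in> edges \<Gamma>" "e = K `` {d}" by (auto elim: quotientE)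
    have "src (quotient_graph \<Gamma> K) e = K `` {src \<Gamma> d}"
      unfolding d(2) by (simp add: quotient_graph_def) (rule classes, use stK Kedge d(1) in blast)
    hence "(src \<Gamma> d, u) \<in> K" using Cons.prems(1) eq_equiv_class[OF _ eqK] by simp
    hence "g (src \<Gamma> d) = h (src \<Gamma> d)" using Cons.prems(2) by (simp add: K_def)
    hence "g d = h d" using edge d(1) by blast
    hence gt: "g (tgt \<Gamma> d) = h (tgt \<Gamma> d)" using d(1) g(1) h(1) by (simp add: graph_map_def)
    have "tgt (quotient_graph \<Gamma> K) e = K `` {tgt \<Gamma> d}"
      unfolding d(2) by (simp add: quotient_graph_def) (rule classes, use stK Kedge d(1) in blast)
    thus ?case using Cons.prems(1) Cons.IH[OF _ gt] by simp
  qed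
  \<comment> \<open>If the point of agreement is an edge, its source is a vertex of
    agreement.\<close>
  obtain u where u: "u \<in> verts \<Gamma>" "g u = h u"
  proof (cases "x \<in> verts \<Gamma>")
    case False
    hence "x \<in> edges \<Gamma>" using un by (auto simp: elems_def)
    thus ?thesis using x g(1) h(1) gr by (intro that[of "src \<Gamma> x"]) (auto simp: graph_map_def is_graph_def)
  qed (use x that in blast)
  have vert: "g v = h v" if "v \<in> verts \<Gamma>" for v
  proof -
    have "K `` {u} \<in> verts (quotient_graph \<Gamma> K)" "K `` {v} \<in> verts (quotient_graph \<Gamma> K)"
      using u(1) that by (auto simp: quotient_graph_def intro: quotientI)
    then obtain es where "edge_path (quotient_graph \<Gamma> K) (K `` {u}) es (K `` {v})"
      using conn unfolding graph_path_connected_def by blast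
    thus ?thesis using path u(2) by blast
  qed
  show ?thesis
  proof
    fix y show "g y = h y"
      using vert edge gr un by (cases "y \<in> verts \<Gamma>") (auto simp: is_graph_def elems_def)
  qed
qed

section \<open>The group of covering transformations\<close>

lemma carrier_Aut [simp]: "carrier (Aut \<Gamma> f) = covering_transformations \<Gamma> f"
  and mult_Aut [simp]: "g \<otimes>\<^bsub>Aut \<Gamma> f\<^esub> h = g \<circ> h"
  and one_Aut [simp]: "\<one>\<^bsub>Aut \<Gamma> f\<^esub> = id"
  by (simp_all add: Aut_def)

lemma covering_transformations_id: "id \<in> covering_transformations \<Gamma> f"
  unfolding covering_transformations_def graph_map_def
  by (auto intro!: exI[of _ id] simp: homeomorphism_def)

lemma covering_transformations_comp:
  assumes "g \<in> covering_transformations \<Gamma> f" "h \<in> covering_transformations \<Gamma> f"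
  shows "g \<circ> h \<in> covering_transformations \<Gamma> f"
proof -
  obtain k l where "homeomorphism UNIV UNIV g k" "homeomorphism UNIV UNIV h l"
    using assms by (auto simp: covering_transformations_def)
  hence "homeomorphism UNIV UNIV (g \<circ> h) (l \<circ> k)" by (rule homeomorphism_compose[rotated])
  moreover have "graph_map \<Gamma> \<Gamma> (g \<circ> h)"
    using assms graph_map_comp[of \<Gamma> \<Gamma> h \<Gamma> g] by (simp add: covering_transformations_def comp_def)
  moreover have "f \<circ> (g \<circ> h) = f"
    using assms by (simp add: covering_transformations_def comp_assoc[symmetric])
  ultimately show ?thesis by (auto simp: covering_transformations_def)
qed

text \<open>The point is that the inverse homeomorphism is again a graph map. Vertices and edges
  partition the whole type and \<open>h\<close> preserves both parts, so \<open>h\<close> also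
  reflects them; the equations for \<open>k\<close> then follow by cancelling
  \<open>h\<close>.\<close>

lemma covering_transformations_inverse:
  fixes \<Gamma> :: "'a::topological_space graph"
  assumes \<Gamma>: "is_graph \<Gamma>" "elems \<Gamma> = UNIV" and h: "h \<in> covering_transformations \<Gamma> f"
  obtains k where "k \<in> covering_transformations \<Gamma> f" "k \<circ> h = id" "h \<circ> k = id"
proof -
  obtain k where k: "homeomorphism UNIV UNIV h k" and gm: "graph_map \<Gamma> \<Gamma> h" and fh: "f \<circ> h = f"
    using h by (auto simp: covering_transformations_def)
  have kh: "k (h x) = x" and hk: "h (k x) = x" for x
    using k by (auto simp: homeomorphism_def)
  have VE: "verts \<Gamma> \<inter> edges \<Gamma> = {}" "verts \<Gamma> \<union> edges \<Gamma> = UNIV"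
    using \<Gamma> by (auto simp: is_graph_def elems_def)
  have "v \<in> verts \<Gamma> \<Longrightarrow> h v \<in> verts \<Gamma>" "v \<in> edges \<Gamma> \<Longrightarrow> h v \<in> edges \<Gamma>" for v
    using gm by (auto simp: graph_map_def)
  hence V: "h v \<in> verts \<Gamma> \<longleftrightarrow> v \<in> verts \<Gamma>" and E: "h v \<in> edges \<Gamma> \<longleftrightarrow> v \<in> edges \<Gamma>" for v
    using VE by blast+
  have kE: "k e \<in> edges \<Gamma>" if "e \<in> edges \<Gamma>" for e using that E[of "k e"] hk by simp
  have kV: "k e \<in> verts \<Gamma>" if "e \<in> verts \<Gamma>" for e using that V[of "k e"] hk by simp
  have "k (src \<Gamma> e) = src \<Gamma> (k e) \<and> k (tgt \<Gamma> e) = tgt \<Gamma> (k e) \<and> k (flip \<Gamma> e) = flip \<Gamma> (k e)"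
    if "e \<in> edges \<Gamma>" for e
    using gm kE[OF that] hk kh unfolding graph_map_def by metis
  hence "graph_map \<Gamma> \<Gamma> k" using kE kV by (auto simp: graph_map_def)
  moreover have "f \<circ> k = f" using fh hk by (metis comp_apply ext)
  moreover have "homeomorphism UNIV UNIV k h" using k by (rule homeomorphism_symD)
  ultimately have "k \<in> covering_transformations \<Gamma> f" by (auto simp: covering_transformations_def)
  thus ?thesis using that kh hk by (auto simp: fun_eq_iff)
qed

lemma group_Aut:
  assumes "is_graph \<Gamma>" "elems \<Gamma> = UNIV"
  shows "group (Aut \<Gamma> f)"
proof (rule groupI)
  fix x assume "x \<in> carrier (Aut \<Gamma> f)"
  then obtain k where "k \<in> covering_transformations \<Gamma> f" "k \<circ> x = id"
    using covering_transformations_inverse[OF assms] by (metis carrier_Aut)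
  thus "\<exists>y\<in>carrier (Aut \<Gamma> f). y \<otimes>\<^bsub>Aut \<Gamma> f\<^esub> x = \<one>\<^bsub>Aut \<Gamma> f\<^esub>" by auto
qed (auto simp: covering_transformations_id covering_transformations_comp comp_assoc)

lemma inv_Aut_apply:
  assumes "is_graph \<Gamma>" "elems \<Gamma> = UNIV" "g \<in> covering_transformations \<Gamma> f"
  shows "(inv\<^bsub>Aut \<Gamma> f\<^esub> g) (g x) = x" "g ((inv\<^bsub>Aut \<Gamma> f\<^esub> g) x) = x"
proof -
  interpret group "Aut \<Gamma> f" by (rule group_Aut[OF assms(1,2)])
  show "(inv\<^bsub>Aut \<Gamma> f\<^esub> g) (g x) = x" "g ((inv\<^bsub>Aut \<Gamma> f\<^esub> g) x) = x"
    using l_inv[of g] r_inv[of g] assms(3) by (simp_all add: fun_eq_iff)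
qed

lemma bij_covering_transformation: "g \<in> covering_transformations \<Gamma> f \<Longrightarrow> bij g"
  by (auto simp: covering_transformations_def homeomorphism_def bij_def intro: inj_on_inverseI)

text \<open>\<open>BijGroup\<close> consists of extensional bijections. As
  \<open>elems \<Gamma>\<close> is the whole type, extensionality is vacuous and its product is
  ordinary composition.\<close>

lemma group_action_Aut:
  assumes "is_graph \<Gamma>" "elems \<Gamma> = UNIV"
  shows "group_action (Aut \<Gamma> f) (elems \<Gamma>) (\<lambda>h. h)"
  unfolding group_action_def group_hom_def group_hom_axioms_def hom_def
  using group_Aut[OF assms] group_BijGroup[of "elems \<Gamma>"] assms(2)
  by (auto simp: BijGroup_def Bij_def bij_covering_transformation restrict_def compose_def fun_eq_iff)

section \<open>Invariant entourages\<close>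

text \<open>
  The maps \<open>a i\<close> are the coordinates of \<open>\<Gamma>\<close>, viewed as the limit of the finite graphs \<open>G i\<close>, and
  \<open>F i\<close> are the locally bijective maps whose limit is \<open>f\<close>. The coordinates need not be surjective.
\<close>

locale coordinate_system =
  fixes \<Gamma> :: "'a::{uniform_space,t2_space} graph" and f :: "'a \<Rightarrow> 'b"
    and I :: "'i set" and G :: "'i \<Rightarrow> 'c graph" and D :: "'i \<Rightarrow> 'd graph" and F :: "'i \<Rightarrow> 'c \<Rightarrow> 'd"
    and a :: "'i \<Rightarrow> 'a \<Rightarrow> 'c"
  assumes profinite: "profinite_graph \<Gamma>"
    and nonempty: "I \<noteq> {}"
    and is_graph: "\<And>i. i \<in> I \<Longrightarrow> is_graph (G i)"
    and finite_elems: "\<And>i. i \<in> I \<Longrightarrow> finite (elems (G i))"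
    and loc_bij: "\<And>i. i \<in> I \<Longrightarrow> locally_bijective (G i) (D i) (F i)"
    and graph_map: "\<And>i. i \<in> I \<Longrightarrow> graph_map \<Gamma> (G i) (a i)"
    and open_fibre: "\<And>i c. i \<in> I \<Longrightarrow> open {x. a i x = c}"
    and fibre: "\<And>i x y. i \<in> I \<Longrightarrow> f x = f y \<Longrightarrow> F i (a i x) = F i (a i y)"
    and directed: "\<And>i j. i \<in> I \<Longrightarrow> j \<in> I \<Longrightarrow>
      \<exists>k\<in>I. \<forall>x y. a k x = a k y \<longrightarrow> a i x = a i y \<and> a j x = a j y"
    and separating: "\<And>x y. (\<And>i. i \<in> I \<Longrightarrow> a i x = a i y) \<Longrightarrow> x = y"

text \<open>The coordinates come from composing the isomorphism onto the limit with the projections.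
  Coordinates \<open>i\<close> and \<open>j\<close> are images of coordinate \<open>k\<close> under
  the transition maps when \<open>k\<close> is above both, which gives \<open>directed\<close>;
  injectivity of the isomorphism gives \<open>separating\<close>.\<close>

lemma covering_coordinates:
  fixes \<Gamma> :: "'a::{uniform_space,t2_space} graph"
  assumes "covering TYPE('i) TYPE('c) TYPE('d) \<Gamma> \<Delta> f"
  obtains I :: "'i set" and G :: "'i \<Rightarrow> 'c graph" and D :: "'i \<Rightarrow> 'd graph" and F a
    where "coordinate_system \<Gamma> f I G D F a"
proof -
  obtain I :: "'i set" and leq and G :: "'i \<Rightarrow> 'c graph" and D :: "'i \<Rightarrow> 'd graph" and F \<phi> \<psi> \<alpha> \<beta>
    where sys: "inverse_system_locally_bijective I leq G D F \<phi> \<psi>"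
      and iso: "topological_graph_iso \<Gamma> (limit_graph I leq G \<phi>) (limit_topology I leq G \<phi>) \<alpha>"
      and comm: "\<And>x. \<beta> (f x) = (\<lambda>i\<in>I. F i (\<alpha> x i))"
      and \<Gamma>: "profinite_graph \<Gamma>"
    using assms unfolding covering_def by blast
  let ?L = "limit_graph I leq G \<phi>"
  have un: "elems \<Gamma> = UNIV" using \<Gamma> by (simp add: profinite_graph_def cofinite_graph_def)
  have gm: "graph_map \<Gamma> ?L \<alpha>" and homeo: "homeomorphic_map euclidean (limit_topology I leq G \<phi>) \<alpha>"
    using iso un by (auto simp: topological_graph_iso_def)
  have lim: "\<alpha> x \<in> elems ?L" for x using graph_map_elems[OF gm] un by simp
  have coh: "\<phi> i j (\<alpha> x j) = \<alpha> x i" if "i \<in> I" "j \<in> I" "leq i j" for i j x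
    using lim[of x] that by (auto simp: limit_graph_def elems_def)
  have ext: "\<alpha> x \<in> extensional I" for x
    using lim[of x] by (auto simp: limit_graph_def elems_def PiE_def)
  have inj: "inj \<alpha>" using homeomorphic_imp_injective_map[OF homeo] by simp
  have 1: "I \<noteq> {}" using sys by (simp add: inverse_system_locally_bijective_def directed_set_def)
  have 2: "is_graph (G i) \<and> finite (elems (G i)) \<and> locally_bijective (G i) (D i) (F i)" if "i \<in> I" for i
    using sys that
    by (simp add: inverse_system_locally_bijective_def inverse_system_finite_graphs_def)
  have 3: "graph_map \<Gamma> (G i) (\<lambda>x. \<alpha> x i)" if "i \<in> I" for i
    using gm that unfolding graph_map_def limit_graph_def by (auto simp: Pi_iff PiE_iff)
  have 4: "open {x. \<alpha> x i = c}" if "i \<in> I" for i c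
  proof -
    have "continuous_map euclidean (limit_topology I leq G \<phi>) \<alpha>"
      using homeo by (rule homeomorphic_imp_continuous_map)
    moreover have "continuous_map (limit_topology I leq G \<phi>) (discrete_topology (elems (G i))) (\<lambda>z. z i)"
      unfolding limit_topology_def
      by (rule continuous_map_from_subtopology, rule continuous_map_product_projection[OF that])
    ultimately have "continuous_map euclidean (discrete_topology (elems (G i))) (\<lambda>x. \<alpha> x i)"
      using continuous_map_compose by (fastforce simp: comp_def)
    \<comment> \<open>Intersecting with \<open>elems (G i)\<close> gives an open set of the discrete
      space whether or not \<open>c\<close> belongs to the graph.\<close>
    from openin_continuous_map_preimage[OF this, of "elems (G i) \<inter> {c}"]
    have "open {x. \<alpha> x i \<in> elems (G i) \<inter> {c}}" by simp
    moreover have "\<alpha> x i \<in> elems (G i)" for x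
      using graph_map_elems[OF 3[OF that]] un by simp
    ultimately show ?thesis by simp
  qed
  have 5: "F i (\<alpha> x i) = F i (\<alpha> y i)" if "i \<in> I" "f x = f y" for i x y
  proof -
    have "(\<lambda>i\<in>I. F i (\<alpha> x i)) = (\<lambda>i\<in>I. F i (\<alpha> y i))"
      by (simp only: comm[symmetric] that(2))
    from fun_cong[OF this, of i] show ?thesis using that(1) by simp
  qed
  have 6: "\<exists>k\<in>I. \<forall>x y. \<alpha> x k = \<alpha> y k \<longrightarrow> \<alpha> x i = \<alpha> y i \<and> \<alpha> x j = \<alpha> y j" if "i \<in> I" "j \<in> I" for i j
  proof -
    have "directed_set I leq" using sys unfolding inverse_system_locally_bijective_def by (rule conjunct1)
    hence "\<forall>i\<in>I. \<forall>j\<in>I. \<exists>k\<in>I. leq i k \<and> leq j k" 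
      unfolding directed_set_def by (elim conjE)
    then obtain k where k: "k \<in> I" "leq i k" "leq j k" using \<open>i \<in> I\<close> \<open>j \<in> I\<close> by blast
    have "\<alpha> x i = \<alpha> y i \<and> \<alpha> x j = \<alpha> y j" if "\<alpha> x k = \<alpha> y k" for x y
      using coh[OF \<open>i \<in> I\<close> k(1,2), of x] coh[OF \<open>i \<in> I\<close> k(1,2), of y]
        coh[OF \<open>j \<in> I\<close> k(1,3), of x] coh[OF \<open>j \<in> I\<close> k(1,3), of y] that by simp
    thus ?thesis using k(1) by blast
  qed
  have 7: "x = y" if "\<And>i. i \<in> I \<Longrightarrow> \<alpha> x i = \<alpha> y i" for x y
    using inj ext extensionalityI[of "\<alpha> x" I "\<alpha> y"] that by (metis injD)
  show ?thesis
  proof (rule that)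
    show "coordinate_system \<Gamma> f I G D F (\<lambda>i x. \<alpha> x i)"
      by unfold_locales (fact \<Gamma> 1 3 4 5 6 7 | simp add: 2)+
  qed
qed

context coordinate_system
begin

text \<open>Choose a compatible cofinite \<open>R\<close> inside \<open>W\<close>. Its complement is
  compact and is covered by the open sets of pairs that some coordinate separates. Finitely many
  coordinates suffice, and directedness replaces them by one.\<close>

lemma kernel_base:
  assumes W: "entourage W"
  obtains i where "i \<in> I" "{(x, y). a i x = a i y} \<subseteq> W"
proof -
  obtain R where R: "compatible_cofinite_entourage \<Gamma> R" "R \<subseteq> W"
    using profinite W unfolding profinite_graph_def cofinite_graph_def by blast
  have eqR: "equiv UNIV R" "entourage R"
    using profinite R(1) by (auto simp: profinite_graph_def cofinite_graph_def
        compatible_cofinite_entourage_def compatible_def)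
  have "open {(x, y). (x, y) \<in> R}"
    by (rule open_saturated[OF eqR]) (use eqR(1) in \<open>meson equiv_def symD transD\<close>)
  hence "open R" by simp
  moreover have "compact (UNIV :: ('a \<times> 'a) set)"
    using compact_Times[of "UNIV :: 'a set" "UNIV :: 'a set"] profinite by (simp add: profinite_graph_def)
  ultimately have cpt: "compact (- R)"
    using compact_Int_closed[of UNIV "- R"] by (simp add: closed_Compl)
  have op': "open {(x, y). a i x \<noteq> a i y}" if "i \<in> I" for i
  proof -
    have "equiv UNIV {(x, y). a i x = a i y}"
      by (auto simp: equiv_def refl_on_def sym_def trans_def)
    moreover have "entourage {(x, y). a i x = a i y}"
      using kernel_entourage[OF profinite open_fibre[OF that]] .
    ultimately show ?thesis by (rule open_saturated) auto
  qed
  have cover: "- R \<subseteq> (\<Union>i\<in>I. {(x, y). a i x \<noteq> a i y})"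
  proof
    fix p assume p: "p \<in> - R"
    obtain x y where xy: "p = (x, y)" by (cases p)
    have "x \<noteq> y" using p xy eqR(1) by (auto simp: equiv_def refl_on_def)
    hence "\<exists>i\<in>I. a i x \<noteq> a i y" using separating by blast
    thus "p \<in> (\<Union>i\<in>I. {(x, y). a i x \<noteq> a i y})" using xy by simp
  qed
  obtain J where J: "J \<subseteq> I" "finite J" "- R \<subseteq> (\<Union>i\<in>J. {(x, y). a i x \<noteq> a i y})"
    by (rule compactE_image[OF cpt op' cover])
  have "\<exists>k\<in>I. \<forall>x y. a k x = a k y \<longrightarrow> (\<forall>i\<in>J. a i x = a i y)"
    using J(2,1)
  proof (induction J rule: finite_induct)
    case empty
    thus ?case using nonempty by blast
  next
    case (insert j J)
    have "j \<in> I" "J \<subseteq> I" using insert.prems by simp_all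
    from insert.IH[OF this(2)] obtain k
      where k: "k \<in> I" "\<forall>x y. a k x = a k y \<longrightarrow> (\<forall>i\<in>J. a i x = a i y)" by (rule bexE)
    from directed[OF \<open>j \<in> I\<close> k(1)] obtain l
      where l: "l \<in> I" "\<forall>x y. a l x = a l y \<longrightarrow> a j x = a j y \<and> a k x = a k y" by (rule bexE)
    have "\<forall>i\<in>insert j J. a i x = a i y" if "a l x = a l y" for x y
      using l(2)[rule_format, OF that] k(2)[rule_format, of x y] by simp
    thus ?case using l(1) by blast
  qed
  then obtain k where k: "k \<in> I" "\<forall>x y. a k x = a k y \<longrightarrow> (\<forall>i\<in>J. a i x = a i y)" by (rule bexE)
  have "(x, y) \<in> W" if "a k x = a k y" for x y
    using k(2)[rule_format, OF that] J(3) R(2) by (cases "(x, y) \<in> R") auto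
  hence "{(x, y). a k x = a k y} \<subseteq> W" by blast
  with k(1) show ?thesis by (rule that)
qed

text \<open>The third conclusion, that closeness of \<open>g\<close> to the identity at one point
  spreads to all points, is what yields freeness later.\<close>

lemma invariant_entourage_base:
  assumes conn: "connected_cofinite_graph \<Gamma>" and W: "entourage W"
  obtains R where "invariant_entourage \<Gamma> (Aut \<Gamma> f) (\<lambda>h. h) R" "R \<subseteq> W"
    "\<forall>g\<in>covering_transformations \<Gamma> f. \<forall>x y. (g x, x) \<in> R \<longrightarrow> (g y, y) \<in> R"
proof -
  have gr: "is_graph \<Gamma>" and un: "elems \<Gamma> = UNIV"
    using profinite by (auto simp: profinite_graph_def cofinite_graph_def)
  obtain i where i: "i \<in> I" and iW: "{(x, y). a i x = a i y} \<subseteq> W"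
    by (rule kernel_base[OF W])
  note gm = graph_map[OF i] and Gi = is_graph[OF i]
  let ?A = "covering_transformations \<Gamma> f"
  have gm': "graph_map \<Gamma> (G i) (\<lambda>x. a i (g x))" if "g \<in> ?A" for g
    using that graph_map_comp[OF _ gm, of \<Gamma> g] by (simp add: covering_transformations_def)
  have op': "open {x. a i (g x) = c}" if "g \<in> ?A" for g c
  proof -
    have "continuous_on UNIV g" using that by (auto simp: covering_transformations_def homeomorphism_def)
    from open_vimage[OF open_fibre[OF i] this] show ?thesis by (simp add: vimage_def)
  qed
  \<comment> \<open>Both sides have the same composite with \<open>F i\<close>, because
    \<open>f (g y) = f y = f (h y)\<close>; uniqueness of lifts applies.\<close>
  have eq: "(\<lambda>x. a i (g x)) = (\<lambda>x. a i (h x))"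
    if "g \<in> ?A" "h \<in> ?A" "a i (g x) = a i (h x)" for g h x
  proof (rule lift_unique[OF profinite conn, where \<Lambda> = "G i" and \<Omega> = "D i" and F = "F i" and x = x])
    fix y
    have "f (g y) = f (h y)" using that by (simp add: covering_transformations_def fun_eq_iff)
    thus "F i (a i (g y)) = F i (a i (h y))" by (rule fibre[OF i])
  qed (fact Gi loc_bij[OF i] gm'[OF that(1)] gm'[OF that(2)] op'[OF that(1)] op'[OF that(2)] that(3))+
  \<comment> \<open>By \<open>eq\<close> the elements of \<open>S\<close> are determined by their values at a single point.\<close>
  define S where "S = (\<lambda>g x. a i (g x)) ` ?A"
  define R where "R = {(x, y). \<forall>s\<in>S. s x = s y}"
  have R_iff: "(x, y) \<in> R \<longleftrightarrow> (\<forall>g\<in>?A. a i (g x) = a i (g y))" for x y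
    by (simp add: R_def S_def)
  have "finite S"
  proof (rule inj_on_finite)
    \<comment> \<open>Here \<open>undefined\<close> serves as an arbitrary base point; it lies in
      \<open>\<Gamma>\<close> because the elements of \<open>\<Gamma>\<close> fill the type.\<close>
    show "inj_on (\<lambda>s. s undefined) S" unfolding S_def inj_on_def using eq by blast
    show "(\<lambda>s. s undefined) ` S \<subseteq> elems (G i)"
      unfolding S_def using graph_map_elems[OF gm] un by auto
    show "finite (elems (G i))" by (rule finite_elems[OF i])
  qed
  moreover have "entourage {(x, y). s x = s y}" if "s \<in> S" for s
    using that op' by (auto simp: S_def intro!: kernel_entourage[OF profinite])
  ultimately have "entourage (\<Inter>s\<in>S. {(x, y). s x = s y})" by (rule entourage_INT)
  moreover have "(\<Inter>s\<in>S. {(x, y). s x = s y}) = R" by (auto simp: R_def)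
  ultimately have entR: "entourage R" by simp
  have eqR: "equiv UNIV R" by (auto simp: R_def equiv_def refl_on_def sym_def trans_def)
  have aS: "a i \<in> S" unfolding S_def
    by (rule image_eqI[OF _ covering_transformations_id]) simp
  have Sgm: "s (src \<Gamma> e) = src (G i) (s e) \<and> s (tgt \<Gamma> e) = tgt (G i) (s e) \<and>
      s (flip \<Gamma> e) = flip (G i) (s e)" if "s \<in> S" "e \<in> edges \<Gamma>" for s e
    using that gm' by (auto simp: S_def graph_map_def)
  have "compatible \<Gamma> R"
    unfolding compatible_def un
  proof (intro conjI ballI impI)
    show "equiv UNIV R" by (rule eqR)
    show "(v, e) \<notin> R" if "v \<in> verts \<Gamma>" "e \<in> edges \<Gamma>" for v e
    proof -
      have "a i v \<in> verts (G i)" "a i e \<in> edges (G i)" using that gm by (auto simp: graph_map_def)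
      hence "a i v \<noteq> a i e" using Gi by (auto simp: is_graph_def)
      thus ?thesis using aS by (auto simp: R_def)
    qed
    show "(e, flip \<Gamma> e) \<notin> R" if "e \<in> edges \<Gamma>" for e
    proof -
      have "a i e \<in> edges (G i)" "a i (flip \<Gamma> e) = flip (G i) (a i e)"
        using that gm by (auto simp: graph_map_def)
      hence "a i e \<noteq> a i (flip \<Gamma> e)" using Gi by (metis is_graph_def)
      thus ?thesis using aS by (auto simp: R_def)
    qed
  qed (auto simp: R_def Sgm)
  hence ccR: "compatible_cofinite_entourage \<Gamma> R"
    using entR compact_finite_quotient[OF _ eqR entR] profinite un
    by (simp add: compatible_cofinite_entourage_def profinite_graph_def)
  \<comment> \<open>Composition with \<open>g\<close> on the right sends the family of maps
    \<open>a i \<circ> h\<close> into itself, so \<open>g\<close> preserves the intersection of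
    their kernels.\<close>
  have pres: "(g x, g y) \<in> R" if "g \<in> ?A" "(x, y) \<in> R" for g x y
  proof -
    have "a i (h (g x)) = a i (h (g y))" if h: "h \<in> ?A" for h
    proof -
      have "h \<circ> g \<in> ?A" using h \<open>g \<in> ?A\<close> by (rule covering_transformations_comp)
      hence "a i ((h \<circ> g) x) = a i ((h \<circ> g) y)" using \<open>(x, y) \<in> R\<close> R_iff by blast
      thus ?thesis by simp
    qed
    thus ?thesis by (simp add: R_iff)
  qed
  have "map_prod g g ` R = R" if g: "g \<in> ?A" for g
  proof
    show "map_prod g g ` R \<subseteq> R" using pres[OF g] by auto
    obtain k where k: "k \<in> ?A" "g \<circ> k = id" by (rule covering_transformations_inverse[OF gr un g])
    show "R \<subseteq> map_prod g g ` R"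
    proof clarify
      fix x y assume "(x, y) \<in> R"
      hence "(k x, k y) \<in> R" by (rule pres[OF k(1)])
      moreover have "(x, y) = map_prod g g (k x, k y)" using k(2) by (simp add: fun_eq_iff)
      ultimately show "(x, y) \<in> map_prod g g ` R" by blast
    qed
  qed
  hence inv: "invariant_entourage \<Gamma> (Aut \<Gamma> f) (\<lambda>h. h) R" using ccR by (simp add: invariant_entourage_def)
  have sub: "R \<subseteq> W" using aS iW by (auto simp: R_def)
  \<comment> \<open>For each \<open>h\<close> in the group, \<open>a i \<circ> h \<circ> g\<close>
    and \<open>a i \<circ> h\<close> agree at \<open>x\<close>, hence everywhere by
    \<open>eq\<close>.\<close>
  have move: "(g y, y) \<in> R" if g: "g \<in> ?A" and x: "(g x, x) \<in> R" for g x y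
  proof -
    have "a i (h (g y)) = a i (h y)" if h: "h \<in> ?A" for h
    proof -
      have "a i ((h \<circ> g) x) = a i (h x)" using x h by (simp add: R_iff)
      from eq[OF covering_transformations_comp[OF h g] h this] show ?thesis by (simp add: fun_eq_iff)
    qed
    thus ?thesis by (simp add: R_iff)
  qed
  show ?thesis
  proof (rule that[OF inv sub])
    show "\<forall>g\<in>?A. \<forall>x y. (g x, x) \<in> R \<longrightarrow> (g y, y) \<in> R" using move by blast
  qed
qed

end

section \<open>The topology of the group of covering transformations\<close>

text \<open>For the profiniteness of the group and for equicontinuity, the connectedness of
  \<open>\<Gamma>\<close> and the inverse system enter only through \<open>base\<close>.\<close>

locale invariant_base =
  fixes \<Gamma> :: "'a::{uniform_space,t2_space} graph" and f :: "'a \<Rightarrow> 'b::t2_space"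
  assumes profinite: "profinite_graph \<Gamma>"
    and continuous: "continuous_on UNIV f"
    and base: "\<And>W. entourage W \<Longrightarrow> \<exists>R. invariant_entourage \<Gamma> (Aut \<Gamma> f) (\<lambda>h. h) R \<and> R \<subseteq> W"
begin

abbreviation "\<A> \<equiv> covering_transformations \<Gamma> f"
abbreviation "inv_ent \<equiv> invariant_entourage \<Gamma> (Aut \<Gamma> f) (\<lambda>h. h)"
abbreviation "T \<equiv> action_topology \<Gamma> (Aut \<Gamma> f) (\<lambda>h. h)"

text \<open>For invariant \<open>R\<close> and \<open>g\<close> in the group this is the left coset
  of the subgroup $N_R$ through \<open>g\<close>, expressed as uniform closeness to
  \<open>g\<close>.\<close>

definition nbhd :: "'a rel \<Rightarrow> ('a \<Rightarrow> 'a) \<Rightarrow> ('a \<Rightarrow> 'a) set" where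
  "nbhd R g = {h \<in> \<A>. \<forall>z. (h z, g z) \<in> R}"

lemma gr: "is_graph \<Gamma>" and un: "elems \<Gamma> = UNIV" and cpt: "compact (UNIV :: 'a set)"
  using profinite by (auto simp: profinite_graph_def cofinite_graph_def)

lemma inv_entD:
  assumes "inv_ent R"
  shows "compatible \<Gamma> R" "equiv UNIV R" "entourage R" "(x, x) \<in> R"
    "(x, y) \<in> R \<Longrightarrow> (y, x) \<in> R" "(x, y) \<in> R \<Longrightarrow> (y, z) \<in> R \<Longrightarrow> (x, z) \<in> R"
proof -
  show c: "compatible \<Gamma> R" and "entourage R"
    using assms by (auto simp: invariant_entourage_def compatible_cofinite_entourage_def)
  show e: "equiv UNIV R" using c un by (simp add: compatible_def)
  show "(x, x) \<in> R" using e by (auto simp: equiv_def refl_on_def)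
  show "(x, y) \<in> R \<Longrightarrow> (y, x) \<in> R" using e by (auto simp: equiv_def dest: symD)
  show "(x, y) \<in> R \<Longrightarrow> (y, z) \<in> R \<Longrightarrow> (x, z) \<in> R" using e by (auto simp: equiv_def dest: transD)
qed

lemma inv_ent_apply:
  assumes "inv_ent R" "g \<in> \<A>"
  shows "(g x, g y) \<in> R \<longleftrightarrow> (x, y) \<in> R"
proof -
  have R: "map_prod g g ` R = R" using assms by (simp add: invariant_entourage_def)
  have "inj g" using bij_covering_transformation[OF assms(2)] by (rule bij_is_inj)
  hence "inj (map_prod g g)" by (simp add: prod.inj_map)
  from inj_image_mem_iff[OF this, of "(x, y)" R] R show ?thesis by simp
qed

lemma inv_ent_separates:
  assumes "\<And>R. inv_ent R \<Longrightarrow> (x, y) \<in> R"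
  shows "x = y"
proof (rule ccontr)
  assume "x \<noteq> y"
  then obtain W where W: "entourage W" "(x, y) \<notin> W" by (rule entourage_separates)
  from base[OF W(1)] obtain R where "inv_ent R" "R \<subseteq> W" by blast
  thus False using assms W(2) by blast
qed

lemma inv_ent_in_open:
  assumes "open U" "x \<in> U"
  obtains R where "inv_ent R" "R `` {x} \<subseteq> U"
proof -
  obtain W where W: "entourage W" "W `` {x} \<subseteq> U" by (rule open_separates_entourage[OF assms])
  from base[OF W(1)] obtain R where "inv_ent R" "R \<subseteq> W" by blast
  thus ?thesis using W(2) by (intro that[of R]) auto
qed

section \<open>Basic neighbourhoods and open sets\<close>

text \<open>Invariance of \<open>R\<close> allows applying \<open>g\<close> or its inverse to both
  sides of a closeness relation, which translates between \<open>(l x, x) \<in> R\<close> and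
  \<open>(g (l x), g x) \<in> R\<close>.\<close>

lemma l_coset_entourage_subgroup:
  assumes R: "inv_ent R" and g: "g \<in> \<A>"
  shows "g <#\<^bsub>Aut \<Gamma> f\<^esub> entourage_subgroup \<Gamma> (Aut \<Gamma> f) (\<lambda>h. h) R = nbhd R g"
proof -
  obtain k where k: "k \<in> \<A>" "k \<circ> g = id" "g \<circ> k = id"
    by (rule covering_transformations_inverse[OF gr un g])
  show ?thesis
  proof (intro equalityI subsetI)
    fix h assume "h \<in> g <#\<^bsub>Aut \<Gamma> f\<^esub> entourage_subgroup \<Gamma> (Aut \<Gamma> f) (\<lambda>h. h) R"
    then obtain l where l: "l \<in> \<A>" "\<And>x. (l x, x) \<in> R" "h = g \<circ> l"
      using un by (auto simp: l_coset_def entourage_subgroup_def)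
    thus "h \<in> nbhd R g"
      using covering_transformations_comp[OF g l(1)] inv_ent_apply[OF R g] by (simp add: nbhd_def)
  next
    fix h assume h: "h \<in> nbhd R g"
    have "h = g \<circ> (k \<circ> h)" using k(3) by (simp add: fun_eq_iff)
    moreover have "k \<circ> h \<in> \<A>" using h k(1) covering_transformations_comp by (auto simp: nbhd_def)
    moreover have "((k \<circ> h) x, x) \<in> R" for x
    proof -
      have "(k (h x), k (g x)) \<in> R" using h inv_ent_apply[OF R k(1)] by (simp add: nbhd_def)
      thus ?thesis using k(2) by (simp add: fun_eq_iff)
    qed
    ultimately show "h \<in> g <#\<^bsub>Aut \<Gamma> f\<^esub> entourage_subgroup \<Gamma> (Aut \<Gamma> f) (\<lambda>h. h) R"
      unfolding l_coset_def entourage_subgroup_def by auto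
  qed
qed

lemma openin_T: "openin T U \<longleftrightarrow> U \<subseteq> \<A> \<and> (\<forall>g\<in>U. \<exists>R. inv_ent R \<and> nbhd R g \<subseteq> U)"
proof -
  have "openin T U \<longleftrightarrow> U \<subseteq> carrier (Aut \<Gamma> f) \<and> (\<forall>g\<in>U. \<exists>R. inv_ent R \<and>
      g <#\<^bsub>Aut \<Gamma> f\<^esub> entourage_subgroup \<Gamma> (Aut \<Gamma> f) (\<lambda>h. h) R \<subseteq> U)"
    by (rule openin_action_topology) (simp add: bij_covering_transformation bij_is_inj)
  also have "\<dots> \<longleftrightarrow> U \<subseteq> \<A> \<and> (\<forall>g\<in>U. \<exists>R. inv_ent R \<and> nbhd R g \<subseteq> U)"
  proof (rule conj_cong)
    assume "U \<subseteq> \<A>"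
    hence "g <#\<^bsub>Aut \<Gamma> f\<^esub> entourage_subgroup \<Gamma> (Aut \<Gamma> f) (\<lambda>h. h) R = nbhd R g"
      if "g \<in> U" "inv_ent R" for g R
      using l_coset_entourage_subgroup[OF that(2)] that(1) by blast
    thus "(\<forall>g\<in>U. \<exists>R. inv_ent R \<and>
        g <#\<^bsub>Aut \<Gamma> f\<^esub> entourage_subgroup \<Gamma> (Aut \<Gamma> f) (\<lambda>h. h) R \<subseteq> U) \<longleftrightarrow>
      (\<forall>g\<in>U. \<exists>R. inv_ent R \<and> nbhd R g \<subseteq> U)"
      by (simp cong: conj_cong)
  qed simp
  finally show ?thesis .
qed

lemma nbhd_self: "inv_ent R \<Longrightarrow> g \<in> \<A> \<Longrightarrow> g \<in> nbhd R g"
  by (simp add: nbhd_def inv_entD(4))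

text \<open>By transitivity of \<open>R\<close>, the basic set contains \<open>nbhd R h\<close> for
  each of its members \<open>h\<close>.\<close>

lemma openin_nbhd:
  assumes R: "inv_ent R"
  shows "openin T (nbhd R g)"
  unfolding openin_T
proof (intro conjI ballI)
  show "nbhd R g \<subseteq> \<A>" by (auto simp: nbhd_def)
  fix h assume "h \<in> nbhd R g"
  hence "nbhd R h \<subseteq> nbhd R g" using inv_entD(6)[OF R] unfolding nbhd_def by blast
  thus "\<exists>S. inv_ent S \<and> nbhd S h \<subseteq> nbhd R g" using R by blast
qed

lemma topspace_T: "topspace T = \<A>"
proof
  show "topspace T \<subseteq> \<A>" using openin_topspace[of T] openin_T by blast
  \<comment> \<open>Some invariant \<open>R\<close> must exist, since otherwise only the empty set
    would be open.\<close>
  obtain R where "inv_ent R" using base[of UNIV] by (auto simp: entourage_def)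
  hence "openin T \<A>" unfolding openin_T by (auto simp: nbhd_def)
  thus "\<A> \<subseteq> topspace T" by (rule openin_subset)
qed

section \<open>Continuity of the group operations and separation\<close>

lemma group_A: "group (Aut \<Gamma> f)"
  by (rule group_Aut[OF gr un])

lemma topological_group_T: "topological_group (Aut \<Gamma> f) T"
  unfolding topological_group_def
proof (intro conjI)
  interpret group "Aut \<Gamma> f" by (rule group_A)
  show "group (Aut \<Gamma> f)" by (rule group_A)
  show "topspace T = carrier (Aut \<Gamma> f)" by (simp add: topspace_T)
  show "continuous_map (prod_topology T T) T (\<lambda>(x, y). x \<otimes>\<^bsub>Aut \<Gamma> f\<^esub> y)"
    unfolding continuous_map_def
  proof (intro conjI allI impI)
    show "(\<lambda>(x, y). x \<otimes>\<^bsub>Aut \<Gamma> f\<^esub> y) \<in> topspace (prod_topology T T) \<rightarrow> topspace T"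
      by (auto simp: topspace_T covering_transformations_comp)
    fix U assume U: "openin T U"
    show "openin (prod_topology T T)
      {p \<in> topspace (prod_topology T T). (case p of (x, y) \<Rightarrow> x \<otimes>\<^bsub>Aut \<Gamma> f\<^esub> y) \<in> U}"
      unfolding openin_prod_topology_alt
    proof (intro allI impI)
      fix g h assume "(g, h) \<in> {p \<in> topspace (prod_topology T T). (case p of (x, y) \<Rightarrow> x \<otimes>\<^bsub>Aut \<Gamma> f\<^esub> y) \<in> U}"
      hence gh: "g \<in> \<A>" "h \<in> \<A>" "g \<circ> h \<in> U" by (auto simp: topspace_T)
      from U gh(3) obtain R where R: "inv_ent R" "nbhd R (g \<circ> h) \<subseteq> U" unfolding openin_T by blast
      \<comment> \<open>The same \<open>R\<close> serves for both factors: \<open>g' (h' z)\<close>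
        is close to \<open>g' (h z)\<close> by invariance under \<open>g'\<close>, and this is close
        to \<open>g (h z)\<close>.\<close>
      have "g' \<circ> h' \<in> U" if g': "g' \<in> nbhd R g" and h': "h' \<in> nbhd R h" for g' h'
      proof -
        have "(g' (h' z), g (h z)) \<in> R" for z
        proof (rule inv_entD(6)[OF R(1)])
          show "(g' (h' z), g' (h z)) \<in> R" using g' h' inv_ent_apply[OF R(1)] by (simp add: nbhd_def)
          show "(g' (h z), g (h z)) \<in> R" using g' by (simp add: nbhd_def)
        qed
        hence "g' \<circ> h' \<in> nbhd R (g \<circ> h)"
          using g' h' by (simp add: nbhd_def covering_transformations_comp)
        thus ?thesis using R(2) by blast
      qed
      moreover have "nbhd R g \<subseteq> \<A>" "nbhd R h \<subseteq> \<A>" by (auto simp: nbhd_def)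
      ultimately have "nbhd R g \<times> nbhd R h \<subseteq>
          {p \<in> topspace (prod_topology T T). (case p of (x, y) \<Rightarrow> x \<otimes>\<^bsub>Aut \<Gamma> f\<^esub> y) \<in> U}"
        by (auto simp: topspace_T)
      thus "\<exists>V W. openin T V \<and> openin T W \<and> g \<in> V \<and> h \<in> W \<and> V \<times> W \<subseteq>
          {p \<in> topspace (prod_topology T T). (case p of (x, y) \<Rightarrow> x \<otimes>\<^bsub>Aut \<Gamma> f\<^esub> y) \<in> U}"
        using openin_nbhd[OF R(1)] nbhd_self[OF R(1)] gh(1,2) by blast
    qed
  qed
  show "continuous_map T T (\<lambda>x. inv\<^bsub>Aut \<Gamma> f\<^esub> x)"
    unfolding continuous_map_def
  proof (intro conjI allI impI)
    show "(\<lambda>x. inv\<^bsub>Aut \<Gamma> f\<^esub> x) \<in> topspace T \<rightarrow> topspace T"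
      using inv_closed by (simp add: topspace_T)
    fix U assume U: "openin T U"
    have "\<exists>R. inv_ent R \<and> nbhd R g \<subseteq> {x \<in> topspace T. inv\<^bsub>Aut \<Gamma> f\<^esub> x \<in> U}"
      if g: "g \<in> \<A>" "inv\<^bsub>Aut \<Gamma> f\<^esub> g \<in> U" for g
    proof -
      from U g(2) obtain R where R: "inv_ent R" "nbhd R (inv\<^bsub>Aut \<Gamma> f\<^esub> g) \<subseteq> U" unfolding openin_T by blast
      have "inv\<^bsub>Aut \<Gamma> f\<^esub> h \<in> nbhd R (inv\<^bsub>Aut \<Gamma> f\<^esub> g)" if h: "h \<in> nbhd R g" for h
      proof -
        have hA: "h \<in> \<A>" using h by (simp add: nbhd_def)
        have "((inv\<^bsub>Aut \<Gamma> f\<^esub> h) z, (inv\<^bsub>Aut \<Gamma> f\<^esub> g) z) \<in> R" for z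
        proof -
          \<comment> \<open>At the preimage of \<open>z\<close> under \<open>g\<close>, the value of
            \<open>g\<close> is \<open>z\<close>, which is also \<open>h\<close> applied to the
            preimage of \<open>z\<close> under \<open>h\<close>. Invariance then cancels
            \<open>h\<close>.\<close>
          have "(h ((inv\<^bsub>Aut \<Gamma> f\<^esub> g) z), g ((inv\<^bsub>Aut \<Gamma> f\<^esub> g) z)) \<in> R" using h by (simp add: nbhd_def)
          hence "(h ((inv\<^bsub>Aut \<Gamma> f\<^esub> g) z), h ((inv\<^bsub>Aut \<Gamma> f\<^esub> h) z)) \<in> R"
            by (simp only: inv_Aut_apply(2)[OF gr un g(1)] inv_Aut_apply(2)[OF gr un hA])
          thus ?thesis using inv_ent_apply[OF R(1) hA] inv_entD(5)[OF R(1)] by blast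
        qed
        thus ?thesis using inv_closed[of h] hA by (simp add: nbhd_def)
      qed
      hence "nbhd R g \<subseteq> {x \<in> topspace T. inv\<^bsub>Aut \<Gamma> f\<^esub> x \<in> U}"
        using R(2) by (auto simp: topspace_T nbhd_def)
      thus ?thesis using R(1) by blast
    qed
    thus "openin T {x \<in> topspace T. inv\<^bsub>Aut \<Gamma> f\<^esub> x \<in> U}"
      unfolding openin_T by (auto simp: topspace_T)
  qed
qed

lemma Hausdorff_T: "Hausdorff_space T"
  unfolding Hausdorff_space_def
proof (intro allI impI, elim conjE)
  fix g h assume "g \<in> topspace T" "h \<in> topspace T" "g \<noteq> h"
  hence gh: "g \<in> \<A>" "h \<in> \<A>" by (auto simp: topspace_T)
  obtain x where "g x \<noteq> h x" using \<open>g \<noteq> h\<close> by blast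
  then obtain R where R: "inv_ent R" "(g x, h x) \<notin> R" using inv_ent_separates by blast
  have "disjnt (nbhd R g) (nbhd R h)"
    unfolding disjnt_iff
  proof (intro allI notI, elim conjE)
    fix k assume "k \<in> nbhd R g" "k \<in> nbhd R h"
    hence "(k x, g x) \<in> R" "(k x, h x) \<in> R" by (auto simp: nbhd_def)
    thus False using R(2) inv_entD(5,6)[OF R(1)] by blast
  qed
  thus "\<exists>U V. openin T U \<and> openin T V \<and> g \<in> U \<and> h \<in> V \<and> disjnt U V"
    using openin_nbhd[OF R(1)] nbhd_self[OF R(1)] gh by blast
qed

section \<open>Compactness of the group\<close>

text \<open>
  A map of the compact space that preserves and reflects all invariant entourages is injective,
  and it permutes the finitely many classes of each of them, so its closed image is everything.
\<close>

lemma covering_transformation_iff: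
  "h \<in> \<A> \<longleftrightarrow> graph_map \<Gamma> \<Gamma> h \<and> (\<forall>x. f (h x) = f x) \<and>
     (\<forall>R. inv_ent R \<longrightarrow> (\<forall>x y. (h x, h y) \<in> R \<longleftrightarrow> (x, y) \<in> R))"
proof (intro iffI)
  assume "h \<in> \<A>"
  thus "graph_map \<Gamma> \<Gamma> h \<and> (\<forall>x. f (h x) = f x) \<and>
     (\<forall>R. inv_ent R \<longrightarrow> (\<forall>x y. (h x, h y) \<in> R \<longleftrightarrow> (x, y) \<in> R))"
    using inv_ent_apply by (auto simp: covering_transformations_def fun_eq_iff)
next
  assume h: "graph_map \<Gamma> \<Gamma> h \<and> (\<forall>x. f (h x) = f x) \<and>
     (\<forall>R. inv_ent R \<longrightarrow> (\<forall>x y. (h x, h y) \<in> R \<longleftrightarrow> (x, y) \<in> R))"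
  hence pres: "(h x, h y) \<in> R \<longleftrightarrow> (x, y) \<in> R" if "inv_ent R" for R x y using that by blast
  have cont: "continuous_on UNIV h"
    unfolding continuous_on_open_vimage[OF open_UNIV]
  proof (intro allI impI)
    fix U :: "'a set" assume U: "open U"
    show "open (h -` U \<inter> UNIV)"
    proof (rule topological_space_class.openI)
      fix x assume "x \<in> h -` U \<inter> UNIV"
      then obtain R where R: "inv_ent R" "R `` {h x} \<subseteq> U"
        using inv_ent_in_open[OF U, of "h x"] by auto
      have "R `` {x} \<subseteq> h -` U \<inter> UNIV" using R(2) pres[OF R(1)] by auto
      moreover have "x \<in> R `` {x}" using inv_entD(4)[OF R(1)] by simp
      ultimately show "\<exists>T. open T \<and> x \<in> T \<and> T \<subseteq> h -` U \<inter> UNIV"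
        using open_entourage_class[OF inv_entD(2,3)[OF R(1)]] by blast
    qed
  qed
  have inj: "inj h"
  proof (rule injI)
    fix x y assume "h x = h y"
    hence "(h x, h y) \<in> R" if "inv_ent R" for R using inv_entD(4)[OF that] by simp
    thus "x = y" using pres inv_ent_separates by blast
  qed
  have surj: "h ` UNIV = UNIV"
  proof (rule ccontr)
    assume "h ` UNIV \<noteq> UNIV"
    then obtain z where z: "z \<in> - range h" by blast
    have "open (- range h)"
      using compact_imp_closed[OF compact_continuous_image[OF cont cpt]] by (simp add: open_Compl)
    then obtain R where R: "inv_ent R" "R `` {z} \<subseteq> - range h" using z by (rule inv_ent_in_open)
    note eqv = inv_entD(2)[OF R(1)]
    \<comment> \<open>\<open>m\<close> is the map induced by \<open>h\<close> on the classes of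
      \<open>R\<close>; preservation of \<open>R\<close> makes it independent of the chosen
      representative, and reflection of \<open>R\<close> makes it injective.\<close>
    define m where "m C = R `` {h (SOME x. x \<in> C)}" for C
    have m: "m (R `` {x}) = R `` {h x}" for x
    proof -
      have "x \<in> R `` {x}" using inv_entD(4)[OF R(1)] by simp
      hence "(SOME y. y \<in> R `` {x}) \<in> R `` {x}" by (rule someI)
      hence "(h x, h (SOME y. y \<in> R `` {x})) \<in> R" using pres[OF R(1)] by simp
      thus ?thesis unfolding m_def using equiv_class_eq[OF eqv] by simp
    qed
    have "inj_on m (UNIV // R)"
    proof (rule inj_onI)
      fix C C' assume "C \<in> UNIV // R" "C' \<in> UNIV // R" and eq: "m C = m C'"
      then obtain x y where xy: "C = R `` {x}" "C' = R `` {y}" by (auto elim!: quotientE)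
      hence "(h x, h y) \<in> R" using eq m eq_equiv_class[OF _ eqv] by simp
      thus "C = C'" using xy pres[OF R(1)] equiv_class_eq[OF eqv] by simp
    qed
    moreover have "m ` (UNIV // R) \<subseteq> UNIV // R" by (auto simp: m_def intro: quotientI)
    moreover have "finite (UNIV // R)" by (rule compact_finite_quotient[OF cpt eqv inv_entD(3)[OF R(1)]])
    ultimately have "m ` (UNIV // R) = UNIV // R" by (intro endo_inj_surj)
    hence "R `` {z} \<in> m ` (UNIV // R)" by (simp add: quotientI)
    then obtain x where "R `` {z} = R `` {h x}" using m by (auto elim!: quotientE)
    hence "h x \<in> R `` {z}" using inv_entD(4)[OF R(1)] by simp
    thus False using R(2) by blast
  qed
  obtain k where "homeomorphism UNIV UNIV h k"
    using homeomorphism_compact[OF cpt cont surj inj] by blast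
  thus "h \<in> \<A>" using h by (auto simp: covering_transformations_def fun_eq_iff)
qed

text \<open>The condition depends only on the \<open>R\<close>-classes of two values of
  \<open>h\<close>. Its failure is thus the preimage of an open set of pairs under evaluation at
  \<open>x\<close> and \<open>y\<close>, which is continuous for pointwise convergence.\<close>

lemma closed_saturated_condition:
  assumes R: "inv_ent R"
    and sat: "\<And>p q p' q'. Q p q \<Longrightarrow> (p, p') \<in> R \<Longrightarrow> (q, q') \<in> R \<Longrightarrow> Q p' q'"
  shows "closed {h :: 'a \<Rightarrow> 'a. Q (h x) (h y)}"
proof -
  have "open {(p, q). \<not> Q p q}"
    by (rule open_saturated[OF inv_entD(2,3)[OF R]]) (use sat inv_entD(5)[OF R] in blast)
  moreover have "continuous_on UNIV (\<lambda>h :: 'a \<Rightarrow> 'a. (h x, h y))"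
    by (intro continuous_on_Pair continuous_on_product_coordinates)
  ultimately have "open ((\<lambda>h :: 'a \<Rightarrow> 'a. (h x, h y)) -` {(p, q). \<not> Q p q})"
    by (rule open_vimage)
  moreover have "(\<lambda>h :: 'a \<Rightarrow> 'a. (h x, h y)) -` {(p, q). \<not> Q p q} = - {h. Q (h x) (h y)}" by auto
  ultimately show ?thesis by (simp add: closed_def)
qed

lemma inv_ent_edge:
  assumes "inv_ent R" "(x, y) \<in> R" "x \<in> edges \<Gamma>"
  shows "y \<in> edges \<Gamma>" "(src \<Gamma> x, src \<Gamma> y) \<in> R" "(tgt \<Gamma> x, tgt \<Gamma> y) \<in> R" "(flip \<Gamma> x, flip \<Gamma> y) \<in> R"
proof -
  note c = inv_entD(1)[OF assms(1)]
  have "y \<in> verts \<Gamma> \<or> y \<in> edges \<Gamma>" using un by (auto simp: elems_def)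
  moreover have "y \<notin> verts \<Gamma>"
    using c assms(3) inv_entD(5)[OF assms(1,2)] by (auto simp: compatible_def)
  ultimately show y: "y \<in> edges \<Gamma>" by blast
  show "(src \<Gamma> x, src \<Gamma> y) \<in> R" "(tgt \<Gamma> x, tgt \<Gamma> y) \<in> R" "(flip \<Gamma> x, flip \<Gamma> y) \<in> R"
    using c assms(2,3) y unfolding compatible_def by blast+
qed

text \<open>An equation such as \<open>h (src \<Gamma> e) = src \<Gamma> (h e)\<close> is the
  intersection, over all invariant \<open>R\<close>, of its versions modulo \<open>R\<close>. Each
  version is a saturated condition because \<open>R\<close> is compatible.\<close>

lemma closed_graph_maps: "closed {h. graph_map \<Gamma> \<Gamma> h}"
proof -
  obtain R\<^sub>0 where R0: "inv_ent R\<^sub>0" using base[of UNIV] by (auto simp: entourage_def)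
  have V: "closed {h :: 'a \<Rightarrow> 'a. h v \<in> verts \<Gamma>}" for v
  proof (rule closed_saturated_condition[OF R0, where Q = "\<lambda>p q. p \<in> verts \<Gamma>" and y = v])
    fix p q p' q' assume p: "p \<in> verts \<Gamma>" "(p, p') \<in> R\<^sub>0"
    hence "p' \<notin> edges \<Gamma>" using inv_ent_edge(1)[OF R0 inv_entD(5)[OF R0 p(2)]] gr
      by (auto simp: is_graph_def)
    thus "p' \<in> verts \<Gamma>" using un by (auto simp: elems_def)
  qed
  have E: "closed {h :: 'a \<Rightarrow> 'a. h e \<in> edges \<Gamma> \<and> h (s e) = s (h e)}"
    if s: "\<And>R x y. inv_ent R \<Longrightarrow> (x, y) \<in> R \<Longrightarrow> x \<in> edges \<Gamma> \<Longrightarrow> (s x, s y) \<in> R"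
    for s :: "'a \<Rightarrow> 'a" and e
  proof -
    \<comment> \<open>Membership of \<open>h e\<close> in the edges is part of the condition because
      \<open>s\<close> is known to respect \<open>R\<close> on edges only.\<close>
    let ?C = "\<lambda>R. {h :: 'a \<Rightarrow> 'a. h e \<in> edges \<Gamma> \<and> (h (s e), s (h e)) \<in> R}"
    have "closed (?C R)" if R: "inv_ent R" for R
    proof (rule closed_saturated_condition[OF R, where Q = "\<lambda>p q. q \<in> edges \<Gamma> \<and> (p, s q) \<in> R"])
      fix p q p' q' assume pq: "q \<in> edges \<Gamma> \<and> (p, s q) \<in> R" "(p, p') \<in> R" "(q, q') \<in> R"
      have "(s q, s q') \<in> R" using s[OF R pq(3)] pq(1) by blast
      hence "(p', s q') \<in> R" using pq inv_entD(5,6)[OF R] by blast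
      thus "q' \<in> edges \<Gamma> \<and> (p', s q') \<in> R" using inv_ent_edge(1)[OF R pq(3)] pq(1) by blast
    qed
    hence "closed (\<Inter>R\<in>Collect inv_ent. ?C R)" by (intro closed_INT) auto
    moreover have "(\<Inter>R\<in>Collect inv_ent. ?C R) = {h :: 'a \<Rightarrow> 'a. h e \<in> edges \<Gamma> \<and> h (s e) = s (h e)}"
    proof (intro equalityI subsetI)
      fix h assume h: "h \<in> (\<Inter>R\<in>Collect inv_ent. ?C R)"
      hence "(h (s e), s (h e)) \<in> R" if "inv_ent R" for R using that by simp
      hence "h (s e) = s (h e)" by (rule inv_ent_separates)
      moreover have "h e \<in> edges \<Gamma>" using h R0 by simp
      ultimately show "h \<in> {h. h e \<in> edges \<Gamma> \<and> h (s e) = s (h e)}" by simp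
    next
      fix h assume "h \<in> {h. h e \<in> edges \<Gamma> \<and> h (s e) = s (h e)}"
      thus "h \<in> (\<Inter>R\<in>Collect inv_ent. ?C R)" using inv_entD(4) by simp
    qed
    ultimately show ?thesis by simp
  qed
  have "closed ((\<Inter>v\<in>verts \<Gamma>. {h :: 'a \<Rightarrow> 'a. h v \<in> verts \<Gamma>}) \<inter>
      (\<Inter>e\<in>edges \<Gamma>. {h. h e \<in> edges \<Gamma> \<and> h (src \<Gamma> e) = src \<Gamma> (h e)} \<inter>
        {h. h e \<in> edges \<Gamma> \<and> h (tgt \<Gamma> e) = tgt \<Gamma> (h e)} \<inter>
        {h. h e \<in> edges \<Gamma> \<and> h (flip \<Gamma> e) = flip \<Gamma> (h e)}))"
    using V E[of "src \<Gamma>", OF inv_ent_edge(2)] E[of "tgt \<Gamma>", OF inv_ent_edge(3)]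
      E[of "flip \<Gamma>", OF inv_ent_edge(4)]
    by (intro closed_Int closed_INT ballI)
  also have "(\<Inter>v\<in>verts \<Gamma>. {h :: 'a \<Rightarrow> 'a. h v \<in> verts \<Gamma>}) \<inter>
      (\<Inter>e\<in>edges \<Gamma>. {h. h e \<in> edges \<Gamma> \<and> h (src \<Gamma> e) = src \<Gamma> (h e)} \<inter>
        {h. h e \<in> edges \<Gamma> \<and> h (tgt \<Gamma> e) = tgt \<Gamma> (h e)} \<inter>
        {h. h e \<in> edges \<Gamma> \<and> h (flip \<Gamma> e) = flip \<Gamma> (h e)}) = {h. graph_map \<Gamma> \<Gamma> h}"
    by (auto simp: graph_map_def)
  finally show ?thesis .
qed

text \<open>By Tychonoff the space of all maps is compact, and every clause of the characterisation
  of \<open>\<A>\<close> by invariant entourages is closed in it.\<close>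

lemma compact_covering_transformations: "compact \<A>"
proof -
  have "compact_space (euclidean :: 'a topology)" using cpt by (simp add: compact_space_def)
  hence "compact_space (product_topology (\<lambda>_. euclidean :: 'a topology) (UNIV :: 'a set))"
    by (simp add: compact_space_product_topology)
  hence UN: "compact (UNIV :: ('a \<Rightarrow> 'a) set)"
    by (simp add: euclidean_product_topology compact_space_def)
  have "closed {h. f (h x) = f x}" for x
  proof -
    have "continuous_on UNIV (\<lambda>h :: 'a \<Rightarrow> 'a. f (h x))"
      using continuous_on_compose2[OF continuous continuous_on_product_coordinates] by simp
    thus ?thesis by (intro closed_Collect_eq) (simp_all add: continuous_on_const)
  qed
  hence fib: "closed (\<Inter>x. {h. f (h x) = f x})" by (intro closed_INT) auto
  have "closed {h. (h x, h y) \<in> R \<longleftrightarrow> (x, y) \<in> R}" if R: "inv_ent R" for R x y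
    by (rule closed_saturated_condition[OF R]) (use inv_entD(5,6)[OF R] in blast)
  hence "closed (\<Inter>R\<in>Collect inv_ent. \<Inter>x. \<Inter>y. {h. (h x, h y) \<in> R \<longleftrightarrow> (x, y) \<in> R})"
    by (intro closed_INT ballI) simp
  hence "closed ({h. graph_map \<Gamma> \<Gamma> h} \<inter> (\<Inter>x. {h. f (h x) = f x}) \<inter>
      (\<Inter>R\<in>Collect inv_ent. \<Inter>x. \<Inter>y. {h. (h x, h y) \<in> R \<longleftrightarrow> (x, y) \<in> R}))"
    by (intro closed_Int closed_graph_maps fib)
  moreover have "{h. graph_map \<Gamma> \<Gamma> h} \<inter> (\<Inter>x. {h. f (h x) = f x}) \<inter>
      (\<Inter>R\<in>Collect inv_ent. \<Inter>x. \<Inter>y. {h. (h x, h y) \<in> R \<longleftrightarrow> (x, y) \<in> R}) = \<A>"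
    by (rule Set.set_eqI) (simp add: covering_transformation_iff)
  ultimately show ?thesis using compact_Int_closed[OF UN] by simp
qed

text \<open>As an element is controlled up to \<open>R\<close> by its values at finitely many points,
  pointwise convergence implies convergence in the group.\<close>

lemma compact_T: "compact_space T"
proof -
  have "continuous_map (top_of_set \<A>) T id"
    unfolding continuous_map_def
  proof (intro conjI allI impI)
    show "id \<in> topspace (top_of_set \<A>) \<rightarrow> topspace T" by (simp add: topspace_T)
    fix U assume U: "openin T U"
    hence UA: "U \<subseteq> \<A>" by (simp add: openin_T)
    have "openin (top_of_set \<A>) U"
    proof (subst openin_subopen, intro ballI)
      fix g assume g: "g \<in> U"
      then obtain R where R: "inv_ent R" "nbhd R g \<subseteq> U" using U unfolding openin_T by blast
      obtain X where X: "finite X" "\<forall>y. \<exists>x\<in>X. (x, y) \<in> R"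
        by (rule finite_representatives[OF cpt inv_entD(2,3)[OF R(1)]])
      define N where "N = (\<Inter>x\<in>X. (\<lambda>h. h x) -` (R `` {g x}))"
      have "open N" unfolding N_def
      proof (rule open_INT[OF X(1)], rule ballI)
        fix x
        show "open ((\<lambda>h :: 'a \<Rightarrow> 'a. h x) -` (R `` {g x}))"
          by (rule open_vimage[OF open_entourage_class[OF inv_entD(2,3)[OF R(1)]]
                continuous_on_product_coordinates])
      qed
      hence "openin (top_of_set \<A>) (\<A> \<inter> N)" by (rule openin_open_Int)
      moreover have "g \<in> \<A> \<inter> N" using g UA inv_entD(4)[OF R(1)] by (auto simp: N_def)
      moreover have "\<A> \<inter> N \<subseteq> U"
      proof
        fix h assume h: "h \<in> \<A> \<inter> N"
        \<comment> \<open>With \<open>x\<close> a representative of the class of \<open>z\<close>,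
          the chain is \<open>h z\<close>, \<open>h x\<close>, \<open>g x\<close>,
          \<open>g z\<close>; its outer links hold by invariance, the middle one by the choice of
          \<open>N\<close>.\<close>
        have "(h z, g z) \<in> R" for z
        proof -
          obtain x where x: "x \<in> X" "(x, z) \<in> R" using X(2) by blast
          have "(h x, h z) \<in> R" "(g x, g z) \<in> R"
            using x(2) inv_ent_apply[OF R(1)] h g UA by blast+
          moreover have "(g x, h x) \<in> R" using h x(1) by (auto simp: N_def)
          ultimately show ?thesis using inv_entD(5,6)[OF R(1)] by blast
        qed
        hence "h \<in> nbhd R g" using h by (simp add: nbhd_def)
        thus "h \<in> U" using R(2) by blast
      qed
      ultimately show "\<exists>N. openin (top_of_set \<A>) N \<and> g \<in> N \<and> N \<subseteq> U" by blast
    qed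
    moreover have "{h \<in> topspace (top_of_set \<A>). id h \<in> U} = U" using UA by auto
    ultimately show "openin (top_of_set \<A>) {h \<in> topspace (top_of_set \<A>). id h \<in> U}" by simp
  qed
  moreover have "compactin (top_of_set \<A>) \<A>"
    using compact_covering_transformations by (simp add: compactin_subtopology)
  ultimately have "compactin T (id ` \<A>)" by (rule image_compactin[rotated])
  thus ?thesis by (simp add: compact_space_def topspace_T)
qed

section \<open>Open normal subgroups of finite index\<close>

lemma entourage_subgroup_eq: "entourage_subgroup \<Gamma> (Aut \<Gamma> f) (\<lambda>h. h) R = nbhd R id"
  using un by (simp add: entourage_subgroup_def nbhd_def)

lemma normal_nbhd:
  assumes R: "inv_ent R"
  shows "nbhd R id \<lhd> Aut \<Gamma> f"
proof -
  interpret group "Aut \<Gamma> f" by (rule group_A)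
  have inv: "inv\<^bsub>Aut \<Gamma> f\<^esub> h \<in> \<A>" if "h \<in> \<A>" for h using inv_closed[of h] that by simp
  have sub: "subgroup (nbhd R id) (Aut \<Gamma> f)"
  proof (rule subgroupI)
    show "nbhd R id \<subseteq> carrier (Aut \<Gamma> f)" by (auto simp: nbhd_def)
    show "nbhd R id \<noteq> {}" using nbhd_self[OF R covering_transformations_id] by blast
  next
    fix h assume h: "h \<in> nbhd R id"
    hence hA: "h \<in> \<A>" by (simp add: nbhd_def)
    have "((inv\<^bsub>Aut \<Gamma> f\<^esub> h) z, z) \<in> R" for z
    proof -
      have "(h ((inv\<^bsub>Aut \<Gamma> f\<^esub> h) z), (inv\<^bsub>Aut \<Gamma> f\<^esub> h) z) \<in> R" using h by (simp add: nbhd_def)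
      thus ?thesis using inv_Aut_apply(2)[OF gr un hA] inv_entD(5)[OF R] by simp
    qed
    thus "inv\<^bsub>Aut \<Gamma> f\<^esub> h \<in> nbhd R id" using inv[OF hA] by (simp add: nbhd_def)
  next
    fix g h assume gh: "g \<in> nbhd R id" "h \<in> nbhd R id"
    have "(g (h z), z) \<in> R" for z
      using gh inv_entD(6)[OF R, of "g (h z)" "h z" z] by (simp add: nbhd_def)
    thus "g \<otimes>\<^bsub>Aut \<Gamma> f\<^esub> h \<in> nbhd R id"
      using gh by (simp add: nbhd_def covering_transformations_comp)
  qed
  \<comment> \<open>Closeness of \<open>h\<close> to the identity at the preimage of
    \<open>z\<close> under \<open>g\<close> is carried by the invariance under \<open>g\<close> to
    closeness of the conjugate at \<open>z\<close>.\<close>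
  have "g \<otimes>\<^bsub>Aut \<Gamma> f\<^esub> h \<otimes>\<^bsub>Aut \<Gamma> f\<^esub> inv\<^bsub>Aut \<Gamma> f\<^esub> g \<in> nbhd R id"
    if g: "g \<in> \<A>" and h: "h \<in> nbhd R id" for g h
  proof -
    have hA: "h \<in> \<A>" using h by (simp add: nbhd_def)
    have "(g (h ((inv\<^bsub>Aut \<Gamma> f\<^esub> g) z)), z) \<in> R" for z
    proof -
      have "(h ((inv\<^bsub>Aut \<Gamma> f\<^esub> g) z), (inv\<^bsub>Aut \<Gamma> f\<^esub> g) z) \<in> R" using h by (simp add: nbhd_def)
      hence "(g (h ((inv\<^bsub>Aut \<Gamma> f\<^esub> g) z)), g ((inv\<^bsub>Aut \<Gamma> f\<^esub> g) z)) \<in> R"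
        using inv_ent_apply[OF R g] by simp
      thus ?thesis using inv_Aut_apply(2)[OF gr un g] by simp
    qed
    moreover have "g \<circ> h \<circ> inv\<^bsub>Aut \<Gamma> f\<^esub> g \<in> \<A>"
      by (intro covering_transformations_comp g hA inv)
    ultimately show ?thesis by (simp add: nbhd_def)
  qed
  thus ?thesis using sub by (simp add: normal_inv_iff)
qed

text \<open>The cosets are open and cover the compact group. Cosets that meet coincide, so a finite
  subcover contains all of them.\<close>

lemma finite_rcosets_nbhd:
  assumes R: "inv_ent R"
  shows "finite (rcosets\<^bsub>Aut \<Gamma> f\<^esub> (nbhd R id))"
proof -
  interpret group "Aut \<Gamma> f" by (rule group_A)
  interpret normal "nbhd R id" "Aut \<Gamma> f" by (rule normal_nbhd[OF R])
  \<comment> \<open>Normality turns right cosets into left cosets, which are the basic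
    neighbourhoods.\<close>
  have coset: "nbhd R id #>\<^bsub>Aut \<Gamma> f\<^esub> g = nbhd R g" if "g \<in> \<A>" for g
    using coset_eq that l_coset_entourage_subgroup[OF R that] by (simp add: entourage_subgroup_eq)
  have "compactin T \<A>" using compact_T by (simp add: compact_space_def topspace_T)
  moreover have "\<A> \<subseteq> \<Union> (nbhd R ` \<A>)" using nbhd_self[OF R] by blast
  ultimately obtain \<F> where \<F>: "finite \<F>" "\<F> \<subseteq> nbhd R ` \<A>" "\<A> \<subseteq> \<Union> \<F>"
    unfolding compactin_def using openin_nbhd[OF R] by (metis imageE)
  have "rcosets\<^bsub>Aut \<Gamma> f\<^esub> (nbhd R id) \<subseteq> \<F>"
  proof
    fix C assume "C \<in> rcosets\<^bsub>Aut \<Gamma> f\<^esub> (nbhd R id)"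
    then obtain g where g: "g \<in> \<A>" "C = nbhd R g" using coset by (auto simp: RCOSETS_def)
    obtain N where N: "N \<in> \<F>" "g \<in> N" using \<F>(3) g(1) by (rule UnionE[OF subsetD])
    then obtain h where "N = nbhd R h" using \<F>(2) by (elim imageE[OF subsetD])
    hence h: "nbhd R h \<in> \<F>" "g \<in> nbhd R h" using N by simp_all
    have gh: "(g z, h z) \<in> R" for z using h(2) by (simp add: nbhd_def)
    have "nbhd R g = nbhd R h"
    proof -
      have "(k z, g z) \<in> R \<longleftrightarrow> (k z, h z) \<in> R" for k z
        using gh[of z] inv_entD(5,6)[OF R] by blast
      thus ?thesis by (simp add: nbhd_def)
    qed
    thus "C \<in> \<F>" using h(1) g(2) by simp
  qed
  thus ?thesis using \<F>(1) finite_subset by blast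
qed

lemma profinite_group_T: "profinite_group (Aut \<Gamma> f) T"
  unfolding profinite_group_def cofinite_group_def
proof (intro conjI allI impI topological_group_T Hausdorff_T compact_T)
  fix U assume "openin T U \<and> \<one>\<^bsub>Aut \<Gamma> f\<^esub> \<in> U"
  then obtain R where "inv_ent R" "nbhd R id \<subseteq> U" unfolding openin_T by auto
  thus "\<exists>N. N \<lhd> Aut \<Gamma> f \<and> finite (rcosets\<^bsub>Aut \<Gamma> f\<^esub> N) \<and> openin T N \<and> N \<subseteq> U"
    using normal_nbhd finite_rcosets_nbhd openin_nbhd by blast
qed

lemma uniformly_equicontinuous_Aut: "uniformly_equicontinuous_action (Aut \<Gamma> f) (\<lambda>h. h)"
  unfolding uniformly_equicontinuous_action_def
proof (intro allI impI)
  fix W :: "'a rel" assume "entourage W"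
  from base[OF this] obtain R where R: "inv_ent R" "R \<subseteq> W" by blast
  have "map_prod g g ` R \<subseteq> W" if "g \<in> \<A>" for g
    using R that by (simp add: invariant_entourage_def)
  thus "\<exists>V. entourage V \<and> (\<forall>g\<in>carrier (Aut \<Gamma> f). map_prod g g ` V \<subseteq> W)"
    using inv_entD(3)[OF R(1)] by auto
qed

end

section \<open>Freeness and conclusion\<close>

theorem theorem10:
  fixes \<Gamma> :: "'a::{uniform_space,t2_space} graph"
    and \<Delta> :: "'b::{uniform_space,t2_space} graph"
    and f :: "'a \<Rightarrow> 'b"
  assumes "covering TYPE('i) TYPE('c) TYPE('d) \<Gamma> \<Delta> f"
    and "connected_cofinite_graph \<Gamma>"
  shows "profinite_group (Aut \<Gamma> f) (action_topology \<Gamma> (Aut \<Gamma> f) (\<lambda>h. h))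
    \<and> group_action (Aut \<Gamma> f) (elems \<Gamma>) (\<lambda>h. h)
    \<and> free_action (Aut \<Gamma> f) (elems \<Gamma>) (\<lambda>h. h)
    \<and> uniformly_equicontinuous_action (Aut \<Gamma> f) (\<lambda>h. h)"
proof -
  obtain I :: "'i set" and G :: "'i \<Rightarrow> 'c graph" and D :: "'i \<Rightarrow> 'd graph" and F a
    where "coordinate_system \<Gamma> f I G D F a"
    by (rule covering_coordinates[OF assms(1)])
  then interpret coordinate_system \<Gamma> f I G D F a .
  interpret invariant_base \<Gamma> f
  proof
    show "continuous_on UNIV f" using assms(1) by (simp add: covering_def)
    fix W :: "'a rel" assume "entourage W"
    then obtain R where "invariant_entourage \<Gamma> (Aut \<Gamma> f) (\<lambda>h. h) R" "R \<subseteq> W"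
      by (rule invariant_entourage_base[OF assms(2)])
    thus "\<exists>R. invariant_entourage \<Gamma> (Aut \<Gamma> f) (\<lambda>h. h) R \<and> R \<subseteq> W" by blast
  qed (rule profinite)
  \<comment> \<open>If \<open>g\<close> moved some \<open>y\<close>, an entourage \<open>W\<close>
    would exclude \<open>(g y, y)\<close>. But the fixed point gives \<open>(g x, x) \<in> R\<close>
    for the invariant \<open>R\<close> inside \<open>W\<close>, and this closeness spreads to
    \<open>y\<close>.\<close>
  have "g = id" if g: "g \<in> \<A>" and x: "g x = x" for g x
  proof (rule ext, rule ccontr)
    fix y assume "g y \<noteq> id y"
    hence "g y \<noteq> y" by simp
    then obtain W where W: "entourage W" "(g y, y) \<notin> W" by (rule entourage_separates)
    obtain R where R: "inv_ent R" "R \<subseteq> W"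
      and move: "\<forall>g\<in>\<A>. \<forall>x y. (g x, x) \<in> R \<longrightarrow> (g y, y) \<in> R"
      by (rule invariant_entourage_base[OF assms(2) W(1)])
    have "(g x, x) \<in> R" using x inv_entD(4)[OF R(1)] by simp
    hence "(g y, y) \<in> R" using move g by blast
    thus False using R(2) W(2) by blast
  qed
  hence "free_action (Aut \<Gamma> f) (elems \<Gamma>) (\<lambda>h. h)" by (auto simp: free_action_def)
  thus ?thesis
    using profinite_group_T group_action_Aut[OF gr un] uniformly_equicontinuous_Aut by blast
qed

end
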